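(* Let $1\leq p\leq\infty$, $\alpha>-1$, and let $\varphi$ be a nonnegative measurable function on $(0,\infty)$. Then $\mathscr H_\varphi$ is bounded on $\mathcal H^p_{|\cdot|^\alpha}(\mathbb C_+)$ if and only if $\int_0^\infty t^{\frac{1+\alpha}{p}-1}|\varphi(t)|\,dt<\infty$; moreover, in this case, $$\|\mathscr H_\varphi\|_{\mathcal H^p_{|\cdot|^\alpha}(\mathbb C_+)\to\mathcal H^p_{|\cdot|^\alpha}(\mathbb C_+)}=\int_0^\infty t^{\frac{1+\alpha}{p}-1}\varphi(t)\,dt.$$
   Context: $\mathbb C_+=\{x+iy\in\mathbb C: y>0\}$ is the upper half-plane. When $p=\infty$, $\frac{1+\alpha}{p}$ is read as $0$. For a measurable function $\varphi$ on $(0,\infty)$, the Hausdorff operator is defined for suitable holomorphic functions $f$ on $\mathbb C_+$ by $\mathscr H_\varphi f(z)=\int_0^\infty f\left(\frac zt\right)\frac{\varphi(t)}{t}\,dt$, $z\in\mathbb C_+$. For $0<p\leq\infty$ and $\alpha>-1$, the power weighted Hardy space $\mathcal H^p_{|\cdot|^\alpha}(\mathbb C_+)$ is the set of all holomorphic functions $f$ on $\mathbb C_+$ with $\|f\|_{\mathcal H^p_{|\cdot|^\alpha}(\mathbb C_+)}<\infty$, where $\|f\|_{\mathcal H^p_{|\cdot|^\alpha}(\mathbb C_+)}:=\sup_{y>0}\left(\int_{-\infty}^\infty|f(x+iy)|^p|x|^\alpha\,dx\right)^{1/p}$ if $0<p<\infty$, and $\|f\|_{\mathcal H^\infty_{|\cdot|^\alpha}(\mathbb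 C_+)}:=\sup_{z\in\mathbb C_+}|f(z)|$. An operator is bounded on a normed space $X$ if it is well-defined on every $f\in X$ (here: the defining integral makes sense as a Lebesgue integral), maps $X$ into $X$, and has finite operator norm $\|\cdot\|_{X\to X}$. *)

theory Defs
  imports "HOL-Complex_Analysis.Complex_Analysis"
begin

definition upper_half_plane :: "complex set" where
  "upper_half_plane = {z. Im z > 0}"

text \<open>Real powers on \<open>[0,\<infinity>]\<close>; only used with a positive exponent, so that \<open>\<infinity>\<close> is sent to \<open>\<infinity>\<close>.\<close>

definition ennreal_powr :: "ennreal \<Rightarrow> real \<Rightarrow> ennreal" where
  "ennreal_powr x r = (if x = \<infinity> then \<infinity> else ennreal (enn2real x powr r))"

definition hardy_exponent :: "ennreal \<Rightarrow> real \<Rightarrow> real" where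
  "hardy_exponent p \<alpha> = (if p = \<infinity> then 0 else (1 + \<alpha>) / enn2real p)"

definition hardy_norm :: "ennreal \<Rightarrow> real \<Rightarrow> (complex \<Rightarrow> complex) \<Rightarrow> ennreal" where
  "hardy_norm p \<alpha> f =
    (if p = \<infinity> then (SUP z\<in>upper_half_plane. ennreal (cmod (f z)))
     else (SUP y\<in>{0<..}. ennreal_powr
       (\<integral>\<^sup>+x. ennreal (cmod (f (Complex x y)) powr enn2real p * \<bar>x\<bar> powr \<alpha>) \<partial>lborel)
       (1 / enn2real p)))"

text \<open>A function on the upper half-plane is represented by a total function whose values off the
  half-plane are irrelevant.\<close>

definition hardy_space :: "ennreal \<Rightarrow> real \<Rightarrow> (complex \<Rightarrow> complex) set" where
  "hardy_space p \<alpha> = {f. f holomorphic_on upper_half_plane \<and> hardy_norm p \<alpha> f < \<infinity>}"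

definition hausdorff_integrand :: "(real \<Rightarrow> real) \<Rightarrow> (complex \<Rightarrow> complex) \<Rightarrow> complex \<Rightarrow> real \<Rightarrow> complex" where
  "hausdorff_integrand \<phi> f z t = f (z / of_real t) * of_real (\<phi> t / t)"

definition hausdorff_op :: "(real \<Rightarrow> real) \<Rightarrow> (complex \<Rightarrow> complex) \<Rightarrow> complex \<Rightarrow> complex" where
  "hausdorff_op \<phi> f z = (LINT t|lebesgue_on {0<..}. hausdorff_integrand \<phi> f z t)"

text \<open>The Bochner integral of a non-integrable function is \<open>0\<close> by convention, so well-definedness has
  to be recorded separately.\<close>

definition hausdorff_defined :: "(real \<Rightarrow> real) \<Rightarrow> (complex \<Rightarrow> complex) \<Rightarrow> bool" where
  "hausdorff_defined \<phi> f \<longleftrightarrow>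
    (\<forall>z\<in>upper_half_plane. integrable (lebesgue_on {0<..}) (hausdorff_integrand \<phi> f z))"

definition hardy_op_norm ::
  "ennreal \<Rightarrow> real \<Rightarrow> ((complex \<Rightarrow> complex) \<Rightarrow> complex \<Rightarrow> complex) \<Rightarrow> ennreal" where
  "hardy_op_norm p \<alpha> T = (SUP f\<in>{f \<in> hardy_space p \<alpha>. hardy_norm p \<alpha> f \<le> 1}. hardy_norm p \<alpha> (T f))"

definition hausdorff_bounded :: "ennreal \<Rightarrow> real \<Rightarrow> (real \<Rightarrow> real) \<Rightarrow> bool" where
  "hausdorff_bounded p \<alpha> \<phi> \<longleftrightarrow>
    (\<forall>f\<in>hardy_space p \<alpha>. hausdorff_defined \<phi> f \<and> hausdorff_op \<phi> f \<in> hardy_space p \<alpha>) \<and>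
    hardy_op_norm p \<alpha> (hausdorff_op \<phi>) < \<infinity>"

end

theory Submission
  imports Defs
begin

text \<open>
  Write \<open>\<sigma> = (1 + \<alpha>) / p\<close>, and let \<open>K\<close> be the integral of \<open>t powr (\<sigma> - 1) * \<phi> t\<close>.

  If \<open>K\<close> is finite, Jensen's inequality for the measure with density \<open>t powr (\<sigma> - 1) * \<phi> t\<close>, Tonelli and
  the scaling of horizontal line integrals under \<open>z \<mapsto> z / t\<close> bound the operator norm by \<open>K\<close>. Point
  evaluations are locally uniformly bounded on the space, so by scaling \<open>f (z / t) = O(t powr \<sigma>)\<close>
  locally uniformly in \<open>z\<close>; hence the defining integral converges and is holomorphic in \<open>z\<close>.

  For the converse with \<open>p < \<infinity>\<close>, the function \<open>z powr (\<epsilon> - \<sigma>) * (1 - \<i> * z) powr (- 2 * \<epsilon>)\<close> has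
  almost constant argument on every ray, so there is no cancellation in the Hausdorff integral.
  Moreover \<open>\<bar>f (z / t)\<bar> \<ge> t powr \<sigma> * min t (1 / t) powr \<epsilon> * \<bar>f z\<bar>\<close>. The image of \<open>f\<close> therefore dominates
  \<open>f\<close> times a constant which tends to \<open>K\<close> as \<open>\<epsilon> \<rightarrow> 0\<close>. For \<open>p = \<infinity>\<close> the constant function \<open>1\<close> suffices.
\<close>

section \<open>Local boundedness of point evaluations\<close>

text \<open>For \<alpha> > 0 the weight degenerates on the imaginary axis, so the line integrals do
  not control \<open>f\<close> there. Cauchy's formula on a rectangle is therefore applied to
  \<open>f\<close> times a polynomial that vanishes where the horizontal sides cross the axis. The
  norm says nothing about an individual vertical line, so the vertical sides are picked by
  averaging. The resulting bound is the same for all \<open>f\<close> with the same norm bound.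
  Scaling needs exactly this uniformity: the normalised dilates of one \<open>f\<close> share their
  norm bound.

  For the converse, \<open>z powr (- \<sigma>)\<close> is formally an eigenfunction with eigenvalue
  \<open>K\<close>, because the operator averages dilations. It misses the space only narrowly: its
  boundary integrand is 1 / |x|, which diverges logarithmically at 0 and at infinity. The two
  \<epsilon>-powers repair both ends. Since \<open>1 - \<i> * z\<close> stays in the right
  half-plane, its argument is below pi / 2, and this limits the rotation along a ray to pi *
  \<epsilon>. In the comparison of norms the norm of the test function cancels, so it only has to be
  finite and non-zero.\<close>

lemma contour_integral_linepath_same_Im:
  assumes "Im z = c" "Im z' = c" "Re z = a" "Re z' = b" "a < b"
  shows "contour_integral (linepath z z') f = integral {a..b} (\<lambda>x. f (Complex x c))"
proof -
  have zz': "z = Complex a c" "z' = Complex b c"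
    using assms by (auto simp: complex_eq_iff)
  have "contour_integral (linepath z z') f =
         (z' - z) * integral {0..1} (\<lambda>x. f (linepath z z' x))"
    by (simp add: contour_integral_integral)
  also have "z' - z = of_real (b - a)"
    by (simp add: zz' Complex_eq algebra_simps)
  also have "integral {0..1} (\<lambda>x. f (linepath z z' x)) =
             integral {0..1} (\<lambda>x. f (Complex (linepath a b x) c))"
    by (simp add: linepath_def Complex_eq scaleR_conv_of_real algebra_simps zz')
  also have "\<dots> = integral {0..(b - a) / (b - a)} (\<lambda>x. f (Complex (a + (b - a) * x) c))"
    using \<open>a < b\<close> by (simp add: algebra_simps linepath_def)
  also have "{0..(b - a) / (b - a)} = (\<lambda>x. x / (b - a)) ` {0..b - a}"
    using \<open>a < b\<close> by simp
  also have "integral \<dots> (\<lambda>x. f (Complex (a + (b - a) * x) c)) =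
             integral {a-a..b-a} (\<lambda>x. f (Complex (x + a) c)) / of_real (b - a)"
    using \<open>a < b\<close> by (subst integral_stretch_real) (auto simp: scaleR_conv_of_real add_ac)
  also have "\<dots> = integral {a..b} (\<lambda>x. f (Complex x c)) / of_real (b - a)"
    by (subst integral_shift_real_ivl) (rule refl)
  finally show ?thesis
    using \<open>a < b\<close> by simp
qed

section \<open>Cauchy's formula on a rectangle\<close>

lemma norm_integral_le_nn_integral:
  fixes h :: "real \<Rightarrow> complex"
  assumes "continuous_on {a..b} h"
  shows "ennreal (cmod (integral {a..b} h)) \<le> (\<integral>\<^sup>+x\<in>{a..b}. ennreal (cmod (h x)) \<partial>lborel)"
proof -
  have int: "set_integrable lborel {a..b} h"
    unfolding set_integrable_def by (rule borel_integrable_compact) (use assms in auto)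
  have "integral {a..b} h = (LINT x:{a..b}|lborel. h x)"
    using set_borel_integral_eq_integral(2)[OF int] by simp
  also have "ennreal (cmod \<dots>) \<le> (\<integral>\<^sup>+x. ennreal (cmod (indicator {a..b} x *\<^sub>R h x)) \<partial>lborel)"
    unfolding set_lebesgue_integral_def
    by (rule integral_norm_bound_ennreal) (use int in \<open>simp add: set_integrable_def\<close>)
  also have "\<dots> = (\<integral>\<^sup>+x\<in>{a..b}. ennreal (cmod (h x)) \<partial>lborel)"
    by (intro nn_integral_cong) (auto split: split_indicator)
  finally show ?thesis .
qed

lemma continuous_on_Complex [continuous_intros]:
  "continuous_on A f \<Longrightarrow> continuous_on A g \<Longrightarrow> continuous_on A (\<lambda>x. Complex (f x) (g x))"
  unfolding Complex_eq by (intro continuous_intros)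

text \<open>Cauchy's formula for \<open>f z / (z - w)\<close>, where \<open>d\<close> bounds the
  denominator from below on the whole boundary. The four sides stay separate because horizontal and
  vertical ones are later estimated by different means.\<close>

lemma rectangle_Cauchy_bound:
  assumes holo: "f holomorphic_on {z. Im z > 0}" and "0 < a" "0 < d"
    and w: "a + d \<le> Im w" "Im w + d \<le> b" "\<bar>Re w\<bar> + d \<le> R"
  shows "ennreal (2 * pi * d * cmod (f w)) \<le>
     (\<integral>\<^sup>+x\<in>{-R..R}. ennreal (cmod (f (Complex x a))) \<partial>lborel) +
     (\<integral>\<^sup>+y\<in>{a..b}. ennreal (cmod (f (Complex R y))) \<partial>lborel) +
     (\<integral>\<^sup>+x\<in>{-R..R}. ennreal (cmod (f (Complex x b))) \<partial>lborel) +
     (\<integral>\<^sup>+y\<in>{a..b}. ennreal (cmod (f (Complex (-R) y))) \<partial>lborel)"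
proof -
  define S where "S = {z::complex. Im z > 0}"
  have S: "open S" "convex S"
    unfolding S_def by (auto simp: open_halfspace_Im_gt convex_halfspace_Im_gt)
  define A C where "A = Complex (-R) a" and "C = Complex R b"
  have ab: "a < b" "0 < R" using w \<open>0 < d\<close> by auto
  define g where "g = (\<lambda>z. f z / (z - w))"
  have wbox: "w \<in> box A C"
    using w \<open>0 < d\<close> by (auto simp: in_box_complex_iff A_def C_def)
  have holg: "continuous_on (S - {w}) g"
    unfolding g_def using holo S_def
    by (intro continuous_intros holomorphic_on_imp_continuous_on[OF holomorphic_on_subset[OF holo]]) auto
  have img: "path_image (rectpath A C) \<subseteq> S - {w}"
    using ab w \<open>0 < a\<close> \<open>0 < d\<close> by (auto simp: path_image_rectpath A_def C_def S_def)
  have "(g has_contour_integral 2 * pi * \<i> * winding_number (rectpath A C) w * f w) (rectpath A C)"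
    unfolding g_def
    by (rule Cauchy_integral_formula_convex_simple[of S])
       (use S holo img w \<open>0 < a\<close> \<open>0 < d\<close> in \<open>auto simp: S_def interior_open\<close>)
  then have ci: "contour_integral (rectpath A C) g = 2 * pi * \<i> * f w"
    using winding_number_rectpath[OF wbox] by (simp add: contour_integral_unique)
  define B D where "B = Complex R a" and "D = Complex (-R) b"
  have pi: "g contour_integrable_on rectpath A C"
    using \<open>(g has_contour_integral _) _\<close> by (auto simp: contour_integrable_on_def)
  have rp: "rectpath A C = linepath A B +++ linepath B C +++ linepath C D +++ linepath D A"
    by (simp add: rectpath_def Let_def A_def B_def C_def D_def)
  have ints: "g contour_integrable_on linepath A B" "g contour_integrable_on linepath B C"
     "g contour_integrable_on linepath C D" "g contour_integrable_on linepath D A"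
    using pi unfolding rp by auto
  have "contour_integral (rectpath A C) g = contour_integral (linepath A B) g +
     contour_integral (linepath B C) g + contour_integral (linepath C D) g + contour_integral (linepath D A) g"
    unfolding rp using ints by simp
  \<comment> \<open>The top and left sides are reversed so that all four sides run in the direction
    of increasing coordinate.\<close>
  also have "contour_integral (linepath C D) g = - contour_integral (linepath D C) g"
    using contour_integral_reversepath[of "linepath D C" g] by simp
  also have "contour_integral (linepath D A) g = - contour_integral (linepath A D) g"
    using contour_integral_reversepath[of "linepath A D" g] by simp
  also have "contour_integral (linepath A B) g = integral {-R..R} (\<lambda>x. g (Complex x a))"
    by (rule contour_integral_linepath_same_Im) (use ab in \<open>auto simp: A_def B_def\<close>)
  also have "contour_integral (linepath D C) g = integral {-R..R} (\<lambda>x. g (Complex x b))"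
    by (rule contour_integral_linepath_same_Im) (use ab in \<open>auto simp: C_def D_def\<close>)
  also have "contour_integral (linepath B C) g = \<i> * integral {a..b} (\<lambda>y. g (Complex R y))"
    by (rule contour_integral_linepath_same_Re) (use ab in \<open>auto simp: C_def B_def\<close>)
  also have "contour_integral (linepath A D) g = \<i> * integral {a..b} (\<lambda>y. g (Complex (-R) y))"
    by (rule contour_integral_linepath_same_Re) (use ab in \<open>auto simp: A_def D_def\<close>)
  finally have eq: "contour_integral (rectpath A C) g = integral {-R..R} (\<lambda>x. g (Complex x a))
     + \<i> * integral {a..b} (\<lambda>y. g (Complex R y)) + - integral {-R..R} (\<lambda>x. g (Complex x b))
     + - (\<i> * integral {a..b} (\<lambda>y. g (Complex (-R) y)))" .
  have tri: "cmod (u1 + u2 + - u3 + - u4) \<le> cmod u1 + cmod u2 + cmod u3 + cmod u4" for u1 u2 u3 u4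
    using norm_triangle_ineq[of "u1 + u2 + - u3" "- u4"] norm_triangle_ineq[of "u1 + u2" "- u3"]
      norm_triangle_ineq[of u1 u2] unfolding norm_minus_cancel by linarith
  have "2 * pi * cmod (f w) = cmod (contour_integral (rectpath A C) g)"
    unfolding ci by (simp add: norm_mult)
  also have "\<dots> \<le> cmod (integral {-R..R} (\<lambda>x. g (Complex x a)))
     + cmod (integral {a..b} (\<lambda>y. g (Complex R y))) + cmod (integral {-R..R} (\<lambda>x. g (Complex x b)))
     + cmod (integral {a..b} (\<lambda>y. g (Complex (-R) y)))" (is "_ \<le> ?rhs")
    unfolding eq by (rule order_trans[OF tri]) (simp add: norm_mult)
  finally have "2 * pi * cmod (f w) \<le> ?rhs" .
  then have "ennreal (d * (2 * pi * cmod (f w))) \<le> ennreal (d * ?rhs)"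
    using \<open>0 < d\<close> by (intro ennreal_leI mult_left_mono) auto
  also have "ennreal (d * ?rhs) = ennreal d * ennreal (cmod (integral {-R..R} (\<lambda>x. g (Complex x a))))
     + ennreal d * ennreal (cmod (integral {a..b} (\<lambda>y. g (Complex R y))))
     + ennreal d * ennreal (cmod (integral {-R..R} (\<lambda>x. g (Complex x b))))
     + ennreal d * ennreal (cmod (integral {a..b} (\<lambda>y. g (Complex (-R) y))))" (is "_ = ?sum")
    using \<open>0 < d\<close> by (simp add: ennreal_mult distrib_left)
  finally have *: "ennreal (d * (2 * pi * cmod (f w))) \<le> ?sum" .
  have seg: "ennreal d * ennreal (cmod (integral {u..v} (\<lambda>x. g (h x)))) \<le>
      (\<integral>\<^sup>+x\<in>{u..v}. ennreal (cmod (f (h x))) \<partial>lborel)"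
    if h: "continuous_on {u..v} h" "\<And>x. x \<in> {u..v} \<Longrightarrow> h x \<in> S \<and> d \<le> cmod (h x - w)" for h and u v :: real
  proof -
    have "continuous_on {u..v} (\<lambda>x. g (h x))"
      by (rule continuous_on_compose2[OF holg h(1)]) (use h(2) \<open>0 < d\<close> in force)
    then have "ennreal d * ennreal (cmod (integral {u..v} (\<lambda>x. g (h x)))) \<le>
        ennreal d * (\<integral>\<^sup>+x\<in>{u..v}. ennreal (cmod (g (h x))) \<partial>lborel)"
      using norm_integral_le_nn_integral[of u v "\<lambda>x. g (h x)"] by (intro mult_left_mono) auto
    also have "\<dots> = (\<integral>\<^sup>+x\<in>{u..v}. ennreal d * ennreal (cmod (g (h x))) \<partial>lborel)"
    proof -
      \<comment> \<open>\<open>g\<close> is only known to be continuous away from \<open>w\<close>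
        inside the half-plane, so measurability is obtained for the extension by zero from the
        segment.\<close>
      have "(\<lambda>x. indicator {u..v} x *\<^sub>R g (h x)) \<in> borel_measurable borel"
        by (rule borel_measurable_continuous_on_indicator) (use \<open>continuous_on {u..v} (\<lambda>x. g (h x))\<close> in auto)
      then have "(\<lambda>x. ennreal (cmod (indicator {u..v} x *\<^sub>R g (h x)))) \<in> borel_measurable borel"
        by measurable
      also have "(\<lambda>x. ennreal (cmod (indicator {u..v} x *\<^sub>R g (h x)))) =
         (\<lambda>x. ennreal (cmod (g (h x))) * indicator {u..v} x)"
        by (auto split: split_indicator)
      finally show ?thesis
        by (subst nn_integral_cmult[symmetric]) (auto simp: mult.assoc)
    qed
    also have "\<dots> \<le> (\<integral>\<^sup>+x\<in>{u..v}. ennreal (cmod (f (h x))) \<partial>lborel)"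
    proof (intro nn_integral_mono)
      fix x
      have "d * cmod (g (h x)) \<le> cmod (f (h x))" if "x \<in> {u..v}"
      proof -
        have "0 < cmod (h x - w)" "d \<le> cmod (h x - w)" using h(2)[OF that] \<open>0 < d\<close> by linarith+
        then show ?thesis
          using mult_left_mono[of d "cmod (h x - w)" "cmod (f (h x))"]
            by (auto simp: g_def norm_divide divide_simps mult.commute)
      qed
      then show "ennreal d * ennreal (cmod (g (h x))) * indicator {u..v} x \<le> ennreal (cmod (f (h x))) * indicator {u..v} x"
        using \<open>0 < d\<close> by (auto split: split_indicator simp: ennreal_mult[symmetric] intro!: ennreal_leI)
    qed
    finally show ?thesis .
  qed
  have dist: "d \<le> cmod (z - w)" if "d \<le> \<bar>Re z - Re w\<bar> \<or> d \<le> \<bar>Im z - Im w\<bar>" for z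
    using that abs_Re_le_cmod[of "z - w"] abs_Im_le_cmod[of "z - w"] by auto
  note *
  also have "?sum \<le> (\<integral>\<^sup>+x\<in>{-R..R}. ennreal (cmod (f (Complex x a))) \<partial>lborel) +
     (\<integral>\<^sup>+y\<in>{a..b}. ennreal (cmod (f (Complex R y))) \<partial>lborel) +
     (\<integral>\<^sup>+x\<in>{-R..R}. ennreal (cmod (f (Complex x b))) \<partial>lborel) +
     (\<integral>\<^sup>+y\<in>{a..b}. ennreal (cmod (f (Complex (-R) y))) \<partial>lborel)"
    using w \<open>0 < a\<close> \<open>0 < d\<close>
    by (intro add_mono seg conjI continuous_intros dist) (auto simp: S_def)
  finally show ?thesis by (simp add: mult_ac)
qed

text \<open>Takes the place of Hoelder's inequality in passing from the \<open>q\<close>-th power to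
  the first power. The additive 1 is harmless because only local boundedness is wanted.\<close>

lemma le_one_plus_powr:
  fixes a q :: real
  assumes "0 \<le> a" "1 \<le> q"
  shows "a \<le> 1 + a powr q"
proof (cases "a \<le> 1")
  case False
  then have "a powr 1 \<le> a powr q" using assms by (intro powr_mono) auto
  then show ?thesis using False by simp
qed (use powr_ge_zero[of a q] in linarith)

text \<open>The factor \<open>\<bar>x\<bar> ^ N\<close> with \<open>N\<close> at least \<alpha>
  splits as \<open>\<bar>x\<bar> powr (N - \<alpha>)\<close> times the weight, and the first part is
  bounded on the segment. \<open>L\<close> is kept apart from \<open>R\<close> so that the final
  constant does not depend on which vertical line gets chosen.\<close>

lemma weighted_segment_bound:
  fixes g :: "real \<Rightarrow> complex"
  assumes [measurable]: "g \<in> borel_measurable borel"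
    and "1 \<le> q" and B: "(\<integral>\<^sup>+x. ennreal (cmod (g x) powr q * \<bar>x\<bar> powr \<alpha>) \<partial>lborel) \<le> ennreal B"
    and "0 \<le> B" "0 \<le> R" "R \<le> L" "1 \<le> N" "\<alpha> \<le> real N"
  shows "(\<integral>\<^sup>+x\<in>{-R..R}. ennreal (cmod (g x) * \<bar>x\<bar> ^ N) \<partial>lborel) \<le>
     ennreal (L ^ N * (2 * R) + L powr (real N - \<alpha>) * B)"
proof -
  have pt: "cmod (g x) * \<bar>x\<bar> ^ N \<le> L ^ N + L powr (real N - \<alpha>) * (cmod (g x) powr q * \<bar>x\<bar> powr \<alpha>)"
    if x: "x \<in> {-R..R}" for x
  proof (cases "x = 0")
    case False
    have "\<bar>x\<bar> \<le> L" using x \<open>R \<le> L\<close> by auto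
    have "\<bar>x\<bar> ^ N = \<bar>x\<bar> powr (real N - \<alpha>) * \<bar>x\<bar> powr \<alpha>"
      using False by (simp add: powr_add[symmetric] powr_realpow[symmetric])
    also have "\<dots> \<le> L powr (real N - \<alpha>) * \<bar>x\<bar> powr \<alpha>"
      using \<open>\<bar>x\<bar> \<le> L\<close> \<open>\<alpha> \<le> real N\<close> by (intro mult_right_mono powr_mono2) auto
    finally have 1: "cmod (g x) powr q * \<bar>x\<bar> ^ N \<le> cmod (g x) powr q * (L powr (real N - \<alpha>) * \<bar>x\<bar> powr \<alpha>)"
      by (intro mult_left_mono) auto
    have "cmod (g x) * \<bar>x\<bar> ^ N \<le> (1 + cmod (g x) powr q) * \<bar>x\<bar> ^ N"
      by (intro mult_right_mono le_one_plus_powr) (use assms in auto)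
    also have "\<dots> \<le> L ^ N + cmod (g x) powr q * \<bar>x\<bar> ^ N"
      using \<open>\<bar>x\<bar> \<le> L\<close> by (simp add: distrib_right power_mono)
    finally show ?thesis using 1 by (simp add: mult_ac)
  qed (use assms in \<open>auto simp: power_0_left\<close>)
  have "(\<integral>\<^sup>+x\<in>{-R..R}. ennreal (cmod (g x) * \<bar>x\<bar> ^ N) \<partial>lborel) \<le>
     (\<integral>\<^sup>+x. (ennreal (L ^ N) * indicator {-R..R} x +
        ennreal (L powr (real N - \<alpha>)) * ennreal (cmod (g x) powr q * \<bar>x\<bar> powr \<alpha>)) \<partial>lborel)"
  proof (intro nn_integral_mono)
    fix x
    show "ennreal (cmod (g x) * \<bar>x\<bar> ^ N) * indicator {-R..R} x \<le> ennreal (L ^ N) * indicator {-R..R} x +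
        ennreal (L powr (real N - \<alpha>)) * ennreal (cmod (g x) powr q * \<bar>x\<bar> powr \<alpha>)"
      using ennreal_leI[OF pt[of x]] assms(5,6)
      by (auto split: split_indicator simp: ennreal_mult[symmetric] ennreal_plus[symmetric] simp del: ennreal_plus)
  qed
  also have "\<dots> = ennreal (L ^ N) * ennreal (2 * R) +
       ennreal (L powr (real N - \<alpha>)) * (\<integral>\<^sup>+x. ennreal (cmod (g x) powr q * \<bar>x\<bar> powr \<alpha>) \<partial>lborel)"
    using \<open>0 \<le> R\<close> by (simp add: nn_integral_add nn_integral_cmult)
  also have "\<dots> \<le> ennreal (L ^ N) * ennreal (2 * R) + ennreal (L powr (real N - \<alpha>)) * ennreal B"
    by (intro add_left_mono mult_left_mono B) auto
  also have "\<dots> = ennreal (L ^ N * (2 * R) + L powr (real N - \<alpha>) * B)"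
    using assms by (simp add: ennreal_mult)
  finally show ?thesis .
qed

text \<open>Members of the Hardy space are arbitrary off the half-plane and need not be measurable
  as total functions. Extension by zero provides the Borel integrands on which Tonelli and the
  extraction of constants rely.\<close>

lemma holomorphic_borel_extension:
  assumes "f holomorphic_on S" "open S"
  obtains g where "g \<in> borel_measurable borel" "\<And>z. z \<in> S \<Longrightarrow> g z = f z"
proof
  show "(\<lambda>x. indicator S x *\<^sub>R f x) \<in> borel_measurable borel"
    by (rule borel_measurable_continuous_on_indicator)
      (use assms in \<open>auto intro: holomorphic_on_imp_continuous_on\<close>)
qed auto

lemma measurable_Complex [measurable (raw)]:
  "f \<in> borel_measurable M \<Longrightarrow> g \<in> borel_measurable M \<Longrightarrow> (\<lambda>x. Complex (f x) (g x)) \<in> borel_measurable M"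
  by (simp add: borel_measurable_complex_iff)

text \<open>By Tonelli, the integral over R in [R1, R1 + 1] of the two vertical integrals at R and
  -R is at most 2 * B * (b - a). Some \<open>R\<close> must therefore do about as well as this mean.
  The factor 2 accounts for treating both signs at once; the added 1 turns the comparison of
  integrals into a strict contradiction.\<close>

lemma vertical_line_choice:
  fixes g :: "complex \<Rightarrow> complex"
  assumes [measurable]: "g \<in> borel_measurable borel"
    and B: "\<And>y. y \<in> {a..b} \<Longrightarrow> (\<integral>\<^sup>+x. ennreal (cmod (g (Complex x y)) powr q * \<bar>x\<bar> powr \<alpha>) \<partial>lborel) \<le> ennreal B"
    and "0 \<le> B" "a \<le> b"
  obtains R where "R1 \<le> R" "R \<le> R1 + 1"
    "\<And>s. s \<in> {R, -R} \<Longrightarrow> (\<integral>\<^sup>+y\<in>{a..b}. ennreal (cmod (g (Complex s y)) powr q * \<bar>R\<bar> powr \<alpha>) \<partial>lborel) \<le>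
       ennreal (2 * B * (b - a) + 1)"
proof -
  define G where "G x y = ennreal (cmod (g (Complex x y)) powr q * \<bar>x\<bar> powr \<alpha>)" for x y
  have [measurable]: "(\<lambda>(x, y). G x y) \<in> borel_measurable (lborel \<Otimes>\<^sub>M lborel)"
     "(\<lambda>(x, y). G (-x) y) \<in> borel_measurable (lborel \<Otimes>\<^sub>M lborel)"
     "G x \<in> borel_measurable borel" "(\<lambda>x. G x y) \<in> borel_measurable borel" for x y
    unfolding G_def by measurable
  have [measurable]: "(\<lambda>(y, x). (G x y + G (-x) y) * indicator {a..b} y) \<in> borel_measurable (lborel \<Otimes>\<^sub>M lborel)"
    unfolding G_def by measurable
  let ?V = "\<lambda>x. \<integral>\<^sup>+y\<in>{a..b}. (G x y + G (-x) y) \<partial>lborel"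
  have "\<exists>R\<in>{R1..R1+1}. ?V R \<le> ennreal (2 * B * (b - a) + 1)"
  proof (rule ccontr)
    assume "\<not> ?thesis"
    then have *: "ennreal (2 * B * (b - a) + 1) \<le> ?V R" if "R \<in> {R1..R1+1}" for R
      using that by (meson linear)
    have "ennreal (2 * B * (b - a) + 1) = (\<integral>\<^sup>+x\<in>{R1..R1+1}. ennreal (2 * B * (b - a) + 1) \<partial>lborel)"
      by (simp add: nn_integral_cmult_indicator)
    also have "\<dots> \<le> (\<integral>\<^sup>+x. ?V x \<partial>lborel)"
      by (intro nn_integral_mono) (use * in \<open>auto split: split_indicator\<close>)
    also have "\<dots> = (\<integral>\<^sup>+y. \<integral>\<^sup>+x. (G x y + G (-x) y) * indicator {a..b} y \<partial>lborel \<partial>lborel)"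
      by (rule lborel_pair.Fubini') measurable
    also have "\<dots> \<le> (\<integral>\<^sup>+y. ennreal (2 * B) * indicator {a..b} y \<partial>lborel)"
    proof (intro nn_integral_mono)
      fix y :: real
      have "(\<integral>\<^sup>+x. G (-x) y \<partial>lborel) = (\<integral>\<^sup>+x. G x y \<partial>lborel)"
        using nn_integral_real_affine[of "\<lambda>x. G x y" "-1" 0] by simp
      then have "(\<integral>\<^sup>+x. G x y + G (-x) y \<partial>lborel) = 2 * (\<integral>\<^sup>+x. G x y \<partial>lborel)"
        by (subst nn_integral_add) (auto simp: mult_2)
      also have "\<dots> \<le> 2 * ennreal B" if "y \<in> {a..b}"
        using B[OF that] unfolding G_def by (intro mult_left_mono) auto
      also have "2 * ennreal B = ennreal (2 * B)" using \<open>0 \<le> B\<close> by (simp add: ennreal_mult)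
      finally show "(\<integral>\<^sup>+x. (G x y + G (-x) y) * indicator {a..b} y \<partial>lborel) \<le> ennreal (2 * B) * indicator {a..b} y"
        by (auto split: split_indicator)
    qed
    also have "\<dots> = ennreal (2 * B * (b - a))"
      using \<open>a \<le> b\<close> \<open>0 \<le> B\<close> by (simp add: nn_integral_cmult_indicator ennreal_mult)
    finally show False
      using \<open>a \<le> b\<close> \<open>0 \<le> B\<close> by (simp add: ennreal_le_iff)
  qed
  then obtain R where R: "R \<in> {R1..R1+1}" "?V R \<le> ennreal (2 * B * (b - a) + 1)" by blast
  show thesis
  proof (rule that)
    fix s assume "s \<in> {R, -R}"
    then have "(\<integral>\<^sup>+y\<in>{a..b}. ennreal (cmod (g (Complex s y)) powr q * \<bar>R\<bar> powr \<alpha>) \<partial>lborel) \<le> ?V R"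
      unfolding G_def by (intro nn_integral_mono) (auto split: split_indicator intro: ennreal_leI)
    then show "(\<integral>\<^sup>+y\<in>{a..b}. ennreal (cmod (g (Complex s y)) powr q * \<bar>R\<bar> powr \<alpha>) \<partial>lborel) \<le>
       ennreal (2 * B * (b - a) + 1)" using R(2) by (rule order_trans)
  qed (use R in auto)
qed

text \<open>The order of quantifiers matters: \<open>C\<close> is chosen before \<open>f\<close>,
  because the lemma is later applied with one \<open>C\<close> to a whole family of dilates.\<close>

lemma weighted_Hardy_locally_bounded:
  assumes q: "1 \<le> q" and h: "Im z0 > 0" and "0 \<le> B"
  obtains C where "\<And>f w. f holomorphic_on {z. Im z > 0} \<Longrightarrow>
      (\<And>y. 0 < y \<Longrightarrow> (\<integral>\<^sup>+x. ennreal (cmod (f (Complex x y)) powr q * \<bar>x\<bar> powr \<alpha>) \<partial>lborel) \<le> ennreal B) \<Longrightarrow>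
      w \<in> ball z0 (Im z0 / 4) \<Longrightarrow> cmod (f w) \<le> C"
proof -
  define h where "h = Im z0"
  \<comment> \<open>Points of the ball have imaginary part between 3h/4 and 5h/4, and real part
    within h/4 of that of \<open>z0\<close>. They thus keep distance at least \<open>d\<close> from
    all four sides. \<open>L\<close> will bound the distance from any boundary point to the two
    zeros of the auxiliary polynomial.\<close>
  define a b d where "a = h / 2" and "b = 2 * h" and "d = h / 4"
  define R1 where "R1 = \<bar>Re z0\<bar> + h"
  define L where "L = R1 + 1 + b"
  \<comment> \<open>The \<open>Suc\<close> guarantees a zero of order at least one even for \<alpha>
    = 0.\<close>
  define N where "N = Suc (nat \<lceil>\<bar>\<alpha>\<bar>\<rceil>)"
  \<comment> \<open>A lower bound for the weight on every admissible vertical line.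
    \<open>x powr \<alpha>\<close> is monotone, in a direction that depends on the sign of \<alpha>,
    so its minimum on [R1, R1 + 1] is attained at an endpoint.\<close>
  define m where "m = min (R1 powr \<alpha>) ((R1 + 1) powr \<alpha>)"
  have pos: "0 < h" "0 < a" "a < b" "0 < d" "0 < R1" "0 < L" "0 < m"
    using assms by (auto simp: h_def a_def b_def d_def R1_def L_def m_def add_nonneg_pos add_pos_nonneg)
  have N: "1 \<le> N" "\<alpha> \<le> real N" unfolding N_def by linarith+
  define H where "H = L ^ N * (L ^ N * (2 * (R1 + 1)) + L powr (real N - \<alpha>) * B)"
  define V where "V = L ^ N * L ^ N * ((b - a) + (2 * B * (b - a) + 1) / m)"
  have HV: "0 \<le> H" "0 \<le> V"
    unfolding H_def V_def using pos \<open>0 \<le> B\<close> by (auto intro!: mult_nonneg_nonneg add_nonneg_nonneg)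
  show thesis
  proof (rule that)
    fix f w
    assume f: "f holomorphic_on {z. Im z > 0}"
      and I: "\<And>y. 0 < y \<Longrightarrow> (\<integral>\<^sup>+x. ennreal (cmod (f (Complex x y)) powr q * \<bar>x\<bar> powr \<alpha>) \<partial>lborel) \<le> ennreal B"
      and w: "w \<in> ball z0 (Im z0 / 4)"
    obtain g where [measurable]: "g \<in> borel_measurable borel" and g: "\<And>z. Im z > 0 \<Longrightarrow> g z = f z"
      using holomorphic_borel_extension[OF f open_halfspace_Im_gt] by auto
    have gI: "(\<integral>\<^sup>+x. ennreal (cmod (g (Complex x y)) powr q * \<bar>x\<bar> powr \<alpha>) \<partial>lborel) \<le> ennreal B" if "0 < y" for y
      using I[OF that] g that by simp
    obtain R where R: "R1 \<le> R" "R \<le> R1 + 1" and Rs: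
      "\<And>s. s \<in> {R, -R} \<Longrightarrow> (\<integral>\<^sup>+y\<in>{a..b}. ennreal (cmod (g (Complex s y)) powr q * \<bar>R\<bar> powr \<alpha>) \<partial>lborel) \<le>
       ennreal (2 * B * (b - a) + 1)"
      by (rule vertical_line_choice[of g a b q \<alpha> B R1]) (use gI pos \<open>0 \<le> B\<close> in auto)
    \<comment> \<open>The weight may vanish on the imaginary axis; the zeros of \<open>k\<close> compensate for this where the
      horizontal sides cross that axis.\<close>
    define k where "k = (\<lambda>z. ((z - Complex 0 a) * (z - Complex 0 b)) ^ N)"
    define F where "F = (\<lambda>z. f z * k z)"
    have Lb: "cmod (Complex x y - Complex 0 c) \<le> L" if "\<bar>x\<bar> \<le> R" "y \<in> {a..b}" "c \<in> {a, b}" for x y c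
    proof -
      have "cmod (Complex x y - Complex 0 c) \<le> \<bar>x\<bar> + \<bar>y - c\<bar>"
        using cmod_le[of "Complex x y - Complex 0 c"] by simp
      then show ?thesis using that R pos by (auto simp: L_def)
    qed
    have dw: "\<bar>Re w - Re z0\<bar> < d" "\<bar>Im w - Im z0\<bar> < d"
      using w abs_Re_le_cmod[of "w - z0"] abs_Im_le_cmod[of "w - z0"]
      by (auto simp: dist_norm norm_minus_commute d_def h_def)
    have hor: "(\<integral>\<^sup>+x\<in>{-R..R}. ennreal (cmod (F (Complex x c))) \<partial>lborel) \<le> ennreal H" if c: "c \<in> {a, b}" for c
    proof -
      have c0: "0 < c" "c \<in> {a..b}" using c pos by auto
      have kx: "cmod (k (Complex x c)) \<le> L ^ N * \<bar>x\<bar> ^ N" if "\<bar>x\<bar> \<le> R" for x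
      proof -
        \<comment> \<open>\<open>c'\<close> is the height of the opposite side. The zero on the side
          itself contributes the power of |x|, while the zero on the opposite side is only estimated
          by \<open>L\<close>.\<close>
        define c' where "c' = (if c = a then b else a)"
        have "k (Complex x c) = ((Complex x c - Complex 0 c') * (Complex x c - Complex 0 c)) ^ N"
          using c by (auto simp: k_def c'_def mult_ac)
        moreover have "cmod (Complex x c - Complex 0 c) = \<bar>x\<bar>" by (simp add: cmod_def)
        moreover have "cmod (Complex x c - Complex 0 c') \<le> L"
          by (rule Lb) (use that c0 in \<open>auto simp: c'_def\<close>)
        ultimately show ?thesis
          by (simp add: norm_mult norm_power power_mult_distrib mult_right_mono power_mono)
      qed
      have "(\<integral>\<^sup>+x\<in>{-R..R}. ennreal (cmod (F (Complex x c))) \<partial>lborel) \<le>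
         (\<integral>\<^sup>+x. ennreal (L ^ N) * (ennreal (cmod (g (Complex x c)) * \<bar>x\<bar> ^ N) * indicator {-R..R} x) \<partial>lborel)"
      proof (intro nn_integral_mono)
        fix x
        have "cmod (F (Complex x c)) \<le> L ^ N * (cmod (g (Complex x c)) * \<bar>x\<bar> ^ N)" if "x \<in> {-R..R}"
          using mult_left_mono[OF kx[of x], of "cmod (f (Complex x c))"] that c0
          by (auto simp: F_def norm_mult g mult_ac abs_le_iff)
        then show "ennreal (cmod (F (Complex x c))) * indicator {-R..R} x \<le>
            ennreal (L ^ N) * (ennreal (cmod (g (Complex x c)) * \<bar>x\<bar> ^ N) * indicator {-R..R} x)"
          using pos by (auto split: split_indicator simp: ennreal_mult[symmetric] intro!: ennreal_leI)
      qed
      also have "\<dots> = ennreal (L ^ N) * (\<integral>\<^sup>+x\<in>{-R..R}. ennreal (cmod (g (Complex x c)) * \<bar>x\<bar> ^ N) \<partial>lborel)"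
        by (rule nn_integral_cmult) measurable
      also have "\<dots> \<le> ennreal (L ^ N) * ennreal (L ^ N * (2 * R) + L powr (real N - \<alpha>) * B)"
        by (intro mult_left_mono weighted_segment_bound[OF _ q gI[OF c0(1)]])
          (use \<open>0 \<le> B\<close> pos R N in \<open>auto simp: L_def\<close>)
      also have "\<dots> \<le> ennreal H"
        unfolding H_def using pos R \<open>0 \<le> B\<close>
        by (subst ennreal_mult[symmetric]) (auto intro!: ennreal_leI mult_left_mono add_nonneg_nonneg)
      finally show ?thesis .
    qed
    have ver: "(\<integral>\<^sup>+y\<in>{a..b}. ennreal (cmod (F (Complex s y))) \<partial>lborel) \<le> ennreal V" if s: "s \<in> {R, -R}" for s
    proof -
      have mR: "m \<le> \<bar>R\<bar> powr \<alpha>"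
      proof (cases "0 \<le> \<alpha>")
        case True
        then have "R1 powr \<alpha> \<le> \<bar>R\<bar> powr \<alpha>" using R pos by (intro powr_mono2) auto
        then show ?thesis by (simp add: m_def)
      next
        case False
        then have "(R1 + 1) powr \<alpha> \<le> \<bar>R\<bar> powr \<alpha>" using R pos by (intro powr_mono2') auto
        then show ?thesis by (simp add: m_def)
      qed
      let ?g = "\<lambda>y. ennreal (cmod (g (Complex s y)) powr q * \<bar>R\<bar> powr \<alpha>)"
      have "(\<integral>\<^sup>+y\<in>{a..b}. ennreal (cmod (F (Complex s y))) \<partial>lborel) \<le>
         (\<integral>\<^sup>+y. ennreal (L ^ N * L ^ N) * (indicator {a..b} y + ennreal (1 / m) * (?g y * indicator {a..b} y)) \<partial>lborel)"
      proof (intro nn_integral_mono)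
        fix y
        have "cmod (F (Complex s y)) \<le> L ^ N * L ^ N * (1 + 1 / m * (cmod (g (Complex s y)) powr q * \<bar>R\<bar> powr \<alpha>))"
          if y: "y \<in> {a..b}"
        proof -
          have "cmod (Complex s y - Complex 0 c) \<le> L" if "c \<in> {a, b}" for c
            by (rule Lb) (use that s y R pos in auto)
          then have "cmod (k (Complex s y)) \<le> L ^ N * L ^ N"
            unfolding k_def norm_mult norm_power power_mult_distrib using pos
            by (intro mult_mono power_mono) auto
          moreover have "cmod (f (Complex s y)) \<le> 1 + 1 / m * (cmod (g (Complex s y)) powr q * \<bar>R\<bar> powr \<alpha>)"
          proof -
            have "cmod (f (Complex s y)) = cmod (g (Complex s y))" using y pos g by simp
            also have "\<dots> \<le> 1 + cmod (g (Complex s y)) powr q" by (rule le_one_plus_powr) (use q in auto)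
            also have "cmod (g (Complex s y)) powr q \<le> 1 / m * (cmod (g (Complex s y)) powr q * \<bar>R\<bar> powr \<alpha>)"
              using mR pos by (simp add: field_simps mult_right_mono)
            finally show ?thesis by simp
          qed
          ultimately have "cmod (f (Complex s y)) * cmod (k (Complex s y)) \<le>
             (1 + 1 / m * (cmod (g (Complex s y)) powr q * \<bar>R\<bar> powr \<alpha>)) * (L ^ N * L ^ N)"
            using pos by (intro mult_mono) (auto intro!: add_nonneg_nonneg)
          then show ?thesis by (simp add: F_def norm_mult mult_ac)
        qed
        then show "ennreal (cmod (F (Complex s y))) * indicator {a..b} y \<le>
            ennreal (L ^ N * L ^ N) * (indicator {a..b} y + ennreal (1 / m) * (?g y * indicator {a..b} y))"
          using pos by (auto split: split_indicator intro!: ennreal_leI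
              simp: ennreal_mult[symmetric] ennreal_1[symmetric] ennreal_plus[symmetric] simp del: ennreal_1 ennreal_plus)
      qed
      also have "\<dots> = ennreal (L ^ N * L ^ N) * (ennreal (b - a) + ennreal (1 / m) * (\<integral>\<^sup>+y\<in>{a..b}. ?g y \<partial>lborel))"
        using pos by (simp add: nn_integral_cmult nn_integral_add)
      also have "\<dots> \<le> ennreal (L ^ N * L ^ N) * (ennreal (b - a) + ennreal (1 / m) * ennreal (2 * B * (b - a) + 1))"
        by (intro mult_left_mono add_left_mono Rs s) auto
      also have "\<dots> = ennreal V"
        unfolding V_def using pos \<open>0 \<le> B\<close>
        by (simp add: ennreal_mult[symmetric] ennreal_plus[symmetric] del: ennreal_plus)
      finally show ?thesis .
    qed
    have Fh: "F holomorphic_on {z. Im z > 0}"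
      unfolding F_def k_def by (intro holomorphic_intros f)
    have geo: "a + d \<le> Im w" "Im w + d \<le> b" "\<bar>Re w\<bar> + d \<le> R"
      using dw pos(1) R unfolding a_def b_def d_def R1_def h_def[symmetric] by linarith+
    have "ennreal (2 * pi * d * cmod (F w)) \<le> ennreal H + ennreal V + ennreal H + ennreal V"
      by (rule order_trans[OF rectangle_Cauchy_bound[OF Fh pos(2) pos(4) geo]], intro add_mono hor ver) simp_all
    then have 1: "2 * pi * d * cmod (F w) \<le> 2 * H + 2 * V"
      using HV by (simp add: ennreal_plus[symmetric] del: ennreal_plus)
    \<comment> \<open>The auxiliary polynomial can be divided out again at \<open>w\<close>, because
      \<open>w\<close> is at least \<open>d\<close> away from both heights.\<close>
    have "d ^ N * d ^ N \<le> cmod (k w)"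
      unfolding k_def norm_mult norm_power power_mult_distrib
    proof (intro mult_mono power_mono)
      show "d \<le> cmod (w - Complex 0 a)" "d \<le> cmod (w - Complex 0 b)"
        using abs_Im_le_cmod[of "w - Complex 0 a"] abs_Im_le_cmod[of "w - Complex 0 b"] geo(1,2)
        unfolding minus_complex.sel complex.sel by linarith+
    qed (use pos in auto)
    then have "2 * pi * d * (cmod (f w) * (d ^ N * d ^ N)) \<le> 2 * pi * d * cmod (F w)"
      unfolding F_def norm_mult using pos by (intro mult_left_mono) auto
    from order_trans[OF this 1] have "cmod (f w) * (2 * pi * d * (d ^ N * d ^ N)) \<le> 2 * H + 2 * V"
      by (simp only: mult_ac)
    then show "cmod (f w) \<le> (2 * H + 2 * V) / (2 * pi * d * (d ^ N * d ^ N))"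
      using pos by (subst pos_le_divide_eq) auto
  qed
qed

section \<open>Holomorphic parameter integrals\<close>

text \<open>A local dominating function for \<open>F\<close> itself is enough: Cauchy's inequality
  converts it into one for the derivative on a smaller ball, and the mean value inequality into one
  for the difference quotients. The derivative is measurable in t as a pointwise limit of these
  quotients.\<close>

lemma holomorphic_on_integral:
  fixes F :: "complex \<Rightarrow> 'a \<Rightarrow> complex"
  assumes "open S"
    and holo: "\<And>t. t \<in> space M \<Longrightarrow> (\<lambda>z. F z t) holomorphic_on S"
    and meas: "\<And>z. z \<in> S \<Longrightarrow> F z \<in> borel_measurable M"
    and dom: "\<And>z0. z0 \<in> S \<Longrightarrow> \<exists>r>0. \<exists>w. integrable M w \<and> ball z0 r \<subseteq> S \<and>
       (\<forall>z\<in>ball z0 r. \<forall>t\<in>space M. cmod (F z t) \<le> w t)"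
  shows "(\<lambda>z. integral\<^sup>L M (F z)) holomorphic_on S"
proof -
  have int: "integrable M (F z)" if z: "z \<in> S" for z
  proof -
    obtain r w where "r > 0" "integrable M w"
      "\<forall>z'\<in>ball z r. \<forall>t\<in>space M. cmod (F z' t) \<le> w t"
      using dom[OF z] by blast
    then have "norm (F z t) \<le> norm (w t)" if "t \<in> space M" for t
    proof -
      have "cmod (F z t) \<le> w t"
        using that \<open>r > 0\<close> \<open>\<forall>z'\<in>ball z r. _\<close> by (meson centre_in_ball)
      then show ?thesis by simp
    qed
    then show ?thesis
      by (intro Bochner_Integration.integrable_bound[OF \<open>integrable M w\<close> meas[OF z]] AE_I2) simp
  qed
  have "\<exists>D. ((\<lambda>z. integral\<^sup>L M (F z)) has_field_derivative D) (at z0)" if z0: "z0 \<in> S" for z0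
  proof -
    obtain r w where r: "r > 0" "integrable M w" "ball z0 r \<subseteq> S"
      and w: "\<And>z t. z \<in> ball z0 r \<Longrightarrow> t \<in> space M \<Longrightarrow> cmod (F z t) \<le> w t"
      using dom[OF z0] by blast
    define G where "G = (\<lambda>t. deriv (\<lambda>z. F z t) z0)"
    have der: "((\<lambda>z. F z t) has_field_derivative deriv (\<lambda>z. F z t) z) (at z)"
      if "t \<in> space M" "z \<in> S" for t z
      using holomorphic_derivI[OF holo[OF that(1)] \<open>open S\<close> that(2)] by simp
    have derb: "cmod (deriv (\<lambda>z. F z t) z) \<le> 4 * w t / r"
      if t: "t \<in> space M" and z: "z \<in> ball z0 (r / 2)" for t z
    proof -
      \<comment> \<open>Circles of radius r / 4 about points of the half-size ball stay in the
        region where \<open>w\<close> dominates; this radius is the source of the factor 4 /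
        r.\<close>
      have sub: "cball z (r / 4) \<subseteq> ball z0 r"
      proof
        fix u assume "u \<in> cball z (r / 4)"
        then have "dist z u \<le> r / 4" "dist z0 z < r / 2" using z by auto
        then show "u \<in> ball z0 r"
          using dist_triangle[of z0 u z] \<open>r > 0\<close> by simp
      qed
      have h: "(\<lambda>z. F z t) holomorphic_on cball z (r / 4)"
        using holo[OF t] sub r(3) by (meson holomorphic_on_subset order_trans)
      have "cmod ((deriv ^^ 1) (\<lambda>z. F z t) z) \<le> fact 1 * w t / (r / 4) ^ 1"
      proof (rule Cauchy_inequality)
        show "(\<lambda>z. F z t) holomorphic_on ball z (r / 4)"
          using h by (rule holomorphic_on_subset) auto
        show "continuous_on (cball z (r / 4)) (\<lambda>z. F z t)"
          using h by (rule holomorphic_on_imp_continuous_on)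
        show "cmod (F x t) \<le> w t" if "cmod (z - x) = r / 4" for x
          using sub that by (intro w t) (auto simp: dist_norm)
      qed (use r in auto)
      then show ?thesis by (simp add: field_simps)
    qed
    have "((\<lambda>h. (integral\<^sup>L M (F (z0 + h)) - integral\<^sup>L M (F z0)) / h) \<longlongrightarrow> integral\<^sup>L M G) (at 0)"
      unfolding tendsto_at_iff_sequentially comp_def
    proof (intro allI impI)
      fix X :: "nat \<Rightarrow> complex"
      assume X: "\<forall>i. X i \<in> UNIV - {0}" and lim: "X \<longlonglongrightarrow> 0"
      obtain N where N: "\<And>n. n \<ge> N \<Longrightarrow> cmod (X n) < r / 2"
        using lim r(1) unfolding LIMSEQ_iff by (metis diff_zero half_gt_zero)
      \<comment> \<open>Dropping the first \<open>N\<close> terms puts every increment inside the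
        half-size ball, so the bound holds for all indices, as dominated convergence
        requires.\<close>
      define Y where "Y = (\<lambda>n. X (n + N))"
      have Y: "Y n \<noteq> 0" "cmod (Y n) < r / 2" for n
        using X N by (auto simp: Y_def)
      have limY: "Y \<longlonglongrightarrow> 0" unfolding Y_def using lim by (rule LIMSEQ_ignore_initial_segment)
      have inb: "z0 + Y n \<in> ball z0 (r / 2)" "z0 + Y n \<in> S" for n
      proof -
        show "z0 + Y n \<in> ball z0 (r / 2)" using Y by (simp add: dist_norm)
        then have "z0 + Y n \<in> ball z0 r" using r(1) by auto
        then show "z0 + Y n \<in> S" using r(3) by blast
      qed
      have ptw: "(\<lambda>n. (F (z0 + Y n) t - F z0 t) / Y n) \<longlonglongrightarrow> G t" if t: "t \<in> space M" for t
      proof -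
        have "((\<lambda>h. (F (z0 + h) t - F z0 t) / h) \<longlongrightarrow> G t) (at 0)"
          using der[OF t z0] unfolding G_def by (simp add: DERIV_def)
        then show ?thesis
          using limY Y(1) unfolding tendsto_at_iff_sequentially comp_def by auto
      qed
      have "(\<lambda>n. LINT t|M. (F (z0 + Y n) t - F z0 t) / Y n) \<longlonglongrightarrow> integral\<^sup>L M G"
      proof (rule integral_dominated_convergence)
        show m: "(\<lambda>t. (F (z0 + Y n) t - F z0 t) / Y n) \<in> borel_measurable M" for n
          using meas[OF inb(2)[of n]] meas[OF z0] by measurable
        show "G \<in> borel_measurable M"
          by (rule borel_measurable_LIMSEQ_metric[OF m ptw])
        show "integrable M (\<lambda>t. 4 * w t / r)" using r by auto
        show "AE t in M. (\<lambda>n. (F (z0 + Y n) t - F z0 t) / Y n) \<longlonglongrightarrow> G t"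
          using ptw by auto
        show "AE t in M. cmod ((F (z0 + Y n) t - F z0 t) / Y n) \<le> 4 * w t / r" for n
        proof (rule AE_I2)
          fix t assume t: "t \<in> space M"
          have "cmod (F (z0 + Y n) t - F z0 t) \<le> 4 * w t / r * cmod (z0 + Y n - z0)"
          proof (rule field_differentiable_bound[of "ball z0 (r / 2)" "\<lambda>z. F z t" "deriv (\<lambda>z. F z t)"])
            fix z assume z: "z \<in> ball z0 (r / 2)"
            then have "z \<in> S" using r by auto
            then show "((\<lambda>z. F z t) has_field_derivative deriv (\<lambda>z. F z t) z) (at z within ball z0 (r / 2))"
              using der[OF t] has_field_derivative_at_within by blast
            show "cmod (deriv (\<lambda>z. F z t) z) \<le> 4 * w t / r" by (rule derb[OF t z])
          qed (use inb r in auto)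
          then show "cmod ((F (z0 + Y n) t - F z0 t) / Y n) \<le> 4 * w t / r"
            using Y(1)[of n] by (simp add: norm_divide field_simps)
        qed
      qed
      also have "(\<lambda>n. LINT t|M. (F (z0 + Y n) t - F z0 t) / Y n) =
          (\<lambda>n. (integral\<^sup>L M (F (z0 + Y n)) - integral\<^sup>L M (F z0)) / Y n)"
        using int inb z0 by simp
      finally show "(\<lambda>n. (integral\<^sup>L M (F (z0 + X n)) - integral\<^sup>L M (F z0)) / X n) \<longlonglongrightarrow> integral\<^sup>L M G"
        unfolding Y_def by (rule LIMSEQ_offset)
    qed
    then show ?thesis unfolding DERIV_def by blast
  qed
  then show ?thesis
    using \<open>open S\<close> by (auto simp: holomorphic_on_open)
qed

section \<open>The upper bound\<close>

abbreviation line_integral :: "real \<Rightarrow> real \<Rightarrow> (complex \<Rightarrow> complex) \<Rightarrow> real \<Rightarrow> ennreal" where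
  "line_integral q \<alpha> f y \<equiv> \<integral>\<^sup>+x. ennreal (cmod (f (Complex x y)) powr q * \<bar>x\<bar> powr \<alpha>) \<partial>lborel"

section \<open>Line integrals under roots and dilations\<close>

lemma ennreal_powr_inverse_le_iff:
  assumes "0 < q" "0 \<le> b"
  shows "ennreal_powr X (1 / q) \<le> ennreal b \<longleftrightarrow> X \<le> ennreal (b powr q)"
proof (cases X)
  case (real x)
  have "x powr (1 / q) \<le> b \<longleftrightarrow> x \<le> b powr q"
  proof
    assume "x powr (1 / q) \<le> b"
    then have "(x powr (1 / q)) powr q \<le> b powr q" using assms by (intro powr_mono2) auto
    then show "x \<le> b powr q" using assms real by (simp add: powr_powr)
  next
    assume "x \<le> b powr q"
    then have "x powr (1 / q) \<le> (b powr q) powr (1 / q)" using assms real by (intro powr_mono2) auto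
    then show "x powr (1 / q) \<le> b" using assms by (simp add: powr_powr)
  qed
  then show ?thesis using real assms by (simp add: ennreal_powr_def ennreal_le_iff)
qed (auto simp: ennreal_powr_def top_unique)

text \<open>Removes the outer root and the supremum, so that every estimate for a finite exponent
  can be made on a single horizontal line.\<close>

lemma hardy_norm_le_iff:
  assumes "1 \<le> p" "p \<noteq> \<infinity>" "0 \<le> b"
  shows "hardy_norm p \<alpha> f \<le> ennreal b \<longleftrightarrow>
    (\<forall>y>0. line_integral (enn2real p) \<alpha> f y \<le> ennreal (b powr enn2real p))"
proof -
  have "0 < enn2real p"
    using assms by (simp add: enn2real_positive_iff less_top order_less_le_trans[OF zero_less_one])
  then show ?thesis
    using assms by (simp add: hardy_norm_def SUP_le_iff ennreal_powr_inverse_le_iff Ball_def)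
qed

text \<open>Substituting x = t * u gives a factor \<open>t\<close> from the measure and
  \<open>t powr \<alpha>\<close> from the weight. This is where the exponent (1 + \<alpha>) / p of
  the theorem originates.\<close>

lemma line_integral_dilation:
  assumes [measurable]: "g \<in> borel_measurable borel" and "0 < t"
  shows "line_integral q \<alpha> (\<lambda>z. g (z / of_real t)) y = ennreal (t powr (1 + \<alpha>)) * line_integral q \<alpha> g (y / t)"
proof -
  have C: "Complex (t * x) y / of_real t = Complex x (y / t)" for x
    using \<open>0 < t\<close> by (simp add: complex_eq_iff)
  have "line_integral q \<alpha> (\<lambda>z. g (z / of_real t)) y =
     ennreal t * (\<integral>\<^sup>+x. ennreal (cmod (g (Complex x (y / t))) powr q * \<bar>t * x\<bar> powr \<alpha>) \<partial>lborel)"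
    using \<open>0 < t\<close> by (subst nn_integral_real_affine[where c = t and t = 0]) (auto simp: C)
  also have "(\<integral>\<^sup>+x. ennreal (cmod (g (Complex x (y / t))) powr q * \<bar>t * x\<bar> powr \<alpha>) \<partial>lborel) =
     (\<integral>\<^sup>+x. ennreal (t powr \<alpha>) * ennreal (cmod (g (Complex x (y / t))) powr q * \<bar>x\<bar> powr \<alpha>) \<partial>lborel)"
    using \<open>0 < t\<close> by (intro nn_integral_cong) (simp add: abs_mult powr_mult ennreal_mult[symmetric] mult_ac)
  also have "\<dots> = ennreal (t powr \<alpha>) * line_integral q \<alpha> g (y / t)"
    by (rule nn_integral_cmult) measurable
  finally show ?thesis
    using \<open>0 < t\<close> by (simp add: mult.assoc[symmetric] ennreal_mult[symmetric] powr_add)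
qed

text \<open>By convexity, \<open>x powr q\<close> lies above its tangent at \<open>c\<close>. The
  proof is Young's inequality with weights 1 / q and 1 - 1 / q, a form that includes q = 1.\<close>

lemma powr_tangent_le:
  fixes c x q :: real
  assumes "1 \<le> q" "0 < c" "0 \<le> x"
  shows "q * c powr (q - 1) * x \<le> x powr q + (q - 1) * c powr q"
proof (cases "x = 0")
  case False
  then have x: "0 < x" using assms by simp
  have "(x powr q) powr (1 / q) * (c powr q) powr (1 - 1 / q) \<le> 1 / q * x powr q + (1 - 1 / q) * c powr q"
    by (rule Youngs_inequality_0) (use assms x in auto)
  moreover have "(x powr q) powr (1 / q) = x" using x assms by (simp add: powr_powr)
  moreover have "(c powr q) powr (1 - 1 / q) = c powr (q - 1)"
    using assms by (simp add: powr_powr right_diff_distrib)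
  ultimately have "q * (x * c powr (q - 1)) \<le> q * (1 / q * x powr q + (1 - 1 / q) * c powr q)"
    using assms by (intro mult_left_mono) auto
  also have "\<dots> = x powr q + (q - 1) * c powr q"
    using assms by (simp add: field_simps)
  finally show ?thesis by (simp add: mult_ac)
qed (use assms in auto)

text \<open>Jensen's inequality for the measure with density \<open>W\<close> and total mass
  \<open>K\<close>, obtained by integrating the tangent inequality. \<open>X\<close> is merely a
  finite lower bound for the integral of \<open>W * G\<close>, so that integral itself may be
  infinite.\<close>

lemma weighted_power_mean:
  fixes W G :: "'a \<Rightarrow> real"
  assumes [measurable]: "W \<in> borel_measurable M" "G \<in> borel_measurable M"
    and nn: "\<And>t. t \<in> space M \<Longrightarrow> 0 \<le> W t" "\<And>t. t \<in> space M \<Longrightarrow> 0 \<le> G t"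
    and K: "(\<integral>\<^sup>+t. ennreal (W t) \<partial>M) = ennreal K" "0 \<le> K"
    and X: "ennreal X \<le> (\<integral>\<^sup>+t. ennreal (W t * G t) \<partial>M)" "0 \<le> X" and "1 \<le> q"
  shows "ennreal (X powr q) \<le> ennreal (K powr (q - 1)) * (\<integral>\<^sup>+t. ennreal (W t * G t powr q) \<partial>M)"
proof (cases "X = 0")
  case False
  \<comment> \<open>Total mass zero means \<open>W\<close> vanishes almost everywhere, which forces
    X = 0; afterwards division by \<open>K\<close> is legitimate.\<close>
  have "K \<noteq> 0"
  proof
    assume "K = 0"
    then have "AE t in M. ennreal (W t) = 0" using K by (simp add: nn_integral_0_iff_AE)
    then have "AE t in M. ennreal (W t * G t) = 0"
      by (rule AE_mp) (use nn in \<open>auto intro!: AE_I2 simp: ennreal_eq_0_iff mult_nonpos_nonneg\<close>)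
    then have "(\<integral>\<^sup>+t. ennreal (W t * G t) \<partial>M) = 0" by (simp add: nn_integral_0_iff_AE)
    with X False show False by simp
  qed
  then have K0: "0 < K" and X0: "0 < X" using K X False by auto
  \<comment> \<open>The tangent is taken at the mean value, the point where Jensen's inequality
    loses nothing.\<close>
  define c where "c = X / K"
  have c: "0 < c" using K0 X0 by (simp add: c_def)
  let ?I = "\<integral>\<^sup>+t. ennreal (W t * G t powr q) \<partial>M"
  have cc: "q * c powr (q - 1) * X = q * c powr q * K"
  proof -
    have "c powr (q - 1) * X = c powr (q - 1) * c powr 1 * K" using X0 K0 by (simp add: c_def)
    also have "c powr (q - 1) * c powr 1 = c powr q" by (subst powr_add[symmetric]) simp
    finally show ?thesis by (simp add: mult.assoc)
  qed
  have "ennreal (q * c powr q * K) = ennreal (q * c powr (q - 1)) * ennreal X"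
    unfolding cc[symmetric] using \<open>1 \<le> q\<close> X0 by (simp add: ennreal_mult)
  also have "\<dots> \<le> ennreal (q * c powr (q - 1)) * (\<integral>\<^sup>+t. ennreal (W t * G t) \<partial>M)"
    by (intro mult_left_mono X) auto
  also have "\<dots> = (\<integral>\<^sup>+t. ennreal (q * c powr (q - 1)) * ennreal (W t * G t) \<partial>M)"
    by (rule nn_integral_cmult[symmetric]) measurable
  also have "\<dots> \<le> (\<integral>\<^sup>+t. ennreal (W t * G t powr q) + ennreal ((q - 1) * c powr q) * ennreal (W t) \<partial>M)"
  proof (intro nn_integral_mono)
    fix t assume t: "t \<in> space M"
    have "W t * (q * c powr (q - 1) * G t) \<le> W t * (G t powr q + (q - 1) * c powr q)"
      using nn[OF t] c \<open>1 \<le> q\<close> by (intro mult_left_mono powr_tangent_le) auto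
    then show "ennreal (q * c powr (q - 1)) * ennreal (W t * G t) \<le>
        ennreal (W t * G t powr q) + ennreal ((q - 1) * c powr q) * ennreal (W t)"
      using nn[OF t] \<open>1 \<le> q\<close>
      by (simp add: ennreal_mult[symmetric] ennreal_plus[symmetric] ennreal_le_iff distrib_left mult_ac del: ennreal_plus)
  qed
  also have "\<dots> = ?I + ennreal ((q - 1) * c powr q) * ennreal K"
    by (simp add: nn_integral_add nn_integral_cmult K)
  finally have "ennreal (q * c powr q * K) \<le> ?I + ennreal ((q - 1) * c powr q * K)"
    using \<open>1 \<le> q\<close> K by (simp add: ennreal_mult)
  \<comment> \<open>Writing q = 1 + (q - 1) exposes the same finite summand on both sides, and it
    cancels.\<close>
  moreover have "ennreal (q * c powr q * K) = ennreal (c powr q * K) + ennreal ((q - 1) * c powr q * K)"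
  proof -
    have "q * c powr q * K = c powr q * K + (q - 1) * c powr q * K" by (simp add: algebra_simps)
    then show ?thesis using \<open>1 \<le> q\<close> K by simp
  qed
  ultimately have I: "ennreal (c powr q * K) \<le> ?I"
    by (simp add: ennreal_add_left_cancel_le add.commute)
  have "X powr q = K powr (q - 1) * (c powr q * K)"
    using K0 X0 by (simp add: c_def powr_divide powr_diff)
  then have "ennreal (X powr q) = ennreal (K powr (q - 1)) * ennreal (c powr q * K)"
    using K0 by (simp add: ennreal_mult)
  also have "\<dots> \<le> ennreal (K powr (q - 1)) * ?I" by (intro mult_left_mono I) auto
  finally show ?thesis .
qed (use assms in auto)

text \<open>\<phi> is only Lebesgue measurable, while Tonelli is applied to products of Borel
  measures. Altering \<phi> on a null set leaves all the integrals unchanged, whatever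
  \<open>h\<close> is. The maximum with 0 in the proof restores nonnegativity on that null
  set.\<close>

lemma lebesgue_on_borel_representative:
  fixes \<phi> :: "real \<Rightarrow> real"
  assumes "\<phi> \<in> borel_measurable (lebesgue_on S)" "S \<in> sets borel" "\<And>t. t \<in> S \<Longrightarrow> 0 \<le> \<phi> t"
  obtains \<psi> where "\<psi> \<in> borel_measurable borel" "\<And>t. 0 \<le> \<psi> t"
    "\<And>h :: real \<Rightarrow> real. (\<integral>\<^sup>+t. ennreal (h t * \<phi> t) \<partial>lebesgue_on S) = (\<integral>\<^sup>+t. ennreal (h t * \<psi> t) \<partial>lborel)"
proof -
  have "(\<lambda>t. if t \<in> S then \<phi> t else 0) \<in> borel_measurable lebesgue"
    using assms by (subst borel_measurable_if) auto
  then obtain \<psi>' where \<psi>': "\<psi>' \<in> borel_measurable lborel" "AE t in lborel. (if t \<in> S then \<phi> t else 0) = \<psi>' t"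
    using completion_ex_borel_measurable_real by blast
  show thesis
  proof
    show "(\<lambda>t. max 0 (\<psi>' t)) \<in> borel_measurable borel" using \<psi>'(1) by simp
    show "(\<integral>\<^sup>+t. ennreal (h t * \<phi> t) \<partial>lebesgue_on S) = (\<integral>\<^sup>+t. ennreal (h t * max 0 (\<psi>' t)) \<partial>lborel)"
      for h :: "real \<Rightarrow> real"
    proof -
      have "(\<integral>\<^sup>+t. ennreal (h t * \<phi> t) \<partial>lebesgue_on S) = (\<integral>\<^sup>+t. ennreal (h t * \<phi> t) * indicator S t \<partial>lborel)"
        using assms(2) by (simp add: nn_integral_restrict_space nn_integral_completion)
      also have "\<dots> = (\<integral>\<^sup>+t. ennreal (h t * max 0 (\<psi>' t)) \<partial>lborel)"
      proof (rule nn_integral_cong_AE, rule AE_mp[OF \<psi>'(2)], intro AE_I2 impI)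
        fix t assume "(if t \<in> S then \<phi> t else 0) = \<psi>' t"
        then have "max 0 (\<psi>' t) = (if t \<in> S then \<phi> t else 0)" using assms(3)[of t] by (auto split: if_splits)
        then show "ennreal (h t * \<phi> t) * indicator S t = ennreal (h t * max 0 (\<psi>' t))" by simp
      qed
      finally show ?thesis .
    qed
  qed auto
qed

section \<open>Well-definedness and norm bound of the operator\<close>

lemma hausdorff_integrand_measurable:
  assumes "f holomorphic_on upper_half_plane" "\<phi> \<in> borel_measurable (lebesgue_on {0<..})"
    and z: "z \<in> upper_half_plane"
  shows "hausdorff_integrand \<phi> f z \<in> borel_measurable (lebesgue_on {0<..})"
proof -
  have "continuous_on {0<..} (\<lambda>t. f (z / of_real t))"
    using z by (intro continuous_on_compose2[OF holomorphic_on_imp_continuous_on[OF assms(1)]] continuous_intros)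
      (auto simp: upper_half_plane_def)
  then have "(\<lambda>t. f (z / of_real t)) \<in> borel_measurable (lebesgue_on {0<..})"
    by (rule continuous_imp_measurable_on_sets_lebesgue) simp
  moreover have "(\<lambda>t::real. t) \<in> borel_measurable (lebesgue_on {0<..})"
    by (rule continuous_imp_measurable_on_sets_lebesgue) auto
  ultimately show ?thesis
    using assms(2) unfolding hausdorff_integrand_def by measurable
qed

text \<open>The growth condition makes a constant times
  \<open>t powr (\<sigma> - 1) * \<phi> t\<close> a dominating function near each point. The
  exponent \<sigma> is left free so that p = \<infinity> is covered by \<sigma> = 0.\<close>

lemma hausdorff_op_holomorphic:
  assumes f: "f holomorphic_on upper_half_plane" and \<phi>: "\<phi> \<in> borel_measurable (lebesgue_on {0<..})"
    and nn: "\<And>t. t > 0 \<Longrightarrow> \<phi> t \<ge> 0"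
    and K: "(\<integral>\<^sup>+t. ennreal (t powr (\<sigma> - 1) * \<phi> t) \<partial>lebesgue_on {0<..}) < \<infinity>"
    and dom: "\<And>z0. z0 \<in> upper_half_plane \<Longrightarrow> \<exists>r>0. \<exists>C. ball z0 r \<subseteq> upper_half_plane \<and>
      (\<forall>z\<in>ball z0 r. \<forall>t>0. cmod (f (z / of_real t)) \<le> C * t powr \<sigma>)"
  shows "hausdorff_defined \<phi> f" "hausdorff_op \<phi> f holomorphic_on upper_half_plane"
proof -
  let ?M = "lebesgue_on {0<..} :: real measure"
  have idM: "(\<lambda>t::real. t) \<in> borel_measurable ?M"
    by (rule continuous_imp_measurable_on_sets_lebesgue) auto
  have intw: "integrable ?M (\<lambda>t. t powr (\<sigma> - 1) * \<phi> t)"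
  proof (rule integrableI_nonneg)
    show "(\<lambda>t. t powr (\<sigma> - 1) * \<phi> t) \<in> borel_measurable ?M" using idM \<phi> by measurable
  qed (use nn K in auto)
  have bound: "cmod (hausdorff_integrand \<phi> f z t) \<le> C * (t powr (\<sigma> - 1) * \<phi> t)"
    if "0 < t" "cmod (f (z / of_real t)) \<le> C * t powr \<sigma>" for z t C
  proof -
    have "cmod (f (z / of_real t)) * (\<phi> t / t) \<le> C * t powr \<sigma> * (\<phi> t / t)"
      using that nn[of t] by (intro mult_right_mono) auto
    then show ?thesis
      using that nn[of t] by (simp add: hausdorff_integrand_def norm_mult powr_diff norm_divide)
  qed
  have dom': "\<exists>r>0. \<exists>w. integrable ?M w \<and> ball z0 r \<subseteq> upper_half_plane \<and>
       (\<forall>z\<in>ball z0 r. \<forall>t\<in>space ?M. cmod (hausdorff_integrand \<phi> f z t) \<le> w t)"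
    if z0: "z0 \<in> upper_half_plane" for z0
  proof -
    obtain r C where "r > 0" "ball z0 r \<subseteq> upper_half_plane"
      "\<And>z t. z \<in> ball z0 r \<Longrightarrow> 0 < t \<Longrightarrow> cmod (f (z / of_real t)) \<le> C * t powr \<sigma>"
      using dom[OF z0] by blast
    then show ?thesis
      using intw by (intro exI[of _ r] conjI exI[of _ "\<lambda>t. C * (t powr (\<sigma> - 1) * \<phi> t)"]) (auto intro!: bound)
  qed
  note meas = hausdorff_integrand_measurable[OF f \<phi>]
  have op: "open upper_half_plane" by (simp add: upper_half_plane_def open_halfspace_Im_gt)
  show "hausdorff_defined \<phi> f"
    unfolding hausdorff_defined_def
  proof
    fix z assume z: "z \<in> upper_half_plane"
    obtain r w where "r > 0" "integrable ?M w"
      and w: "\<And>z' t. z' \<in> ball z r \<Longrightarrow> t \<in> space ?M \<Longrightarrow> cmod (hausdorff_integrand \<phi> f z' t) \<le> w t"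
      using dom'[OF z] by blast
    have "norm (hausdorff_integrand \<phi> f z t) \<le> norm (w t)" if "t \<in> space ?M" for t
      using w[OF _ that, of z] \<open>r > 0\<close> by simp
    then show "integrable ?M (hausdorff_integrand \<phi> f z)"
      by (intro Bochner_Integration.integrable_bound[OF \<open>integrable ?M w\<close> meas[OF z]] AE_I2) simp
  qed
  have "(\<lambda>z. hausdorff_integrand \<phi> f z t) holomorphic_on upper_half_plane" if "t \<in> space ?M" for t
  proof -
    have "(f \<circ> (\<lambda>z. z / of_real t)) holomorphic_on upper_half_plane"
      by (rule holomorphic_on_compose_gen[OF _ f]) (use that in \<open>auto simp: upper_half_plane_def intro!: holomorphic_intros\<close>)
    then show ?thesis unfolding hausdorff_integrand_def comp_def by (intro holomorphic_intros)
  qed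
  then show "hausdorff_op \<phi> f holomorphic_on upper_half_plane"
    unfolding hausdorff_op_def by (intro holomorphic_on_integral[OF op _ meas dom']) auto
qed

text \<open>Jensen pointwise in \<open>x\<close> contributes \<open>K powr (q - 1)\<close>; after
  Tonelli, the remaining integral of \<open>W\<close> contributes one more \<open>K\<close>.
  Together they give the sharp factor \<open>K powr q\<close>, as Minkowski's integral inequality
  would.\<close>

lemma hausdorff_op_line_integral_bound:
  assumes q: "1 \<le> q" and f: "f holomorphic_on upper_half_plane" and \<phi>: "\<phi> \<in> borel_measurable (lebesgue_on {0<..})"
    and nn: "\<And>t. t > 0 \<Longrightarrow> \<phi> t \<ge> 0"
    and K: "(\<integral>\<^sup>+t. ennreal (t powr ((1 + \<alpha>) / q - 1) * \<phi> t) \<partial>lebesgue_on {0<..}) = ennreal K" "0 \<le> K"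
    and b: "\<And>y. 0 < y \<Longrightarrow> line_integral q \<alpha> f y \<le> ennreal (b powr q)" "0 \<le> b"
    and "hausdorff_defined \<phi> f" and y: "0 < y"
  shows "line_integral q \<alpha> (hausdorff_op \<phi> f) y \<le> ennreal ((K * b) powr q)"
proof -
  define \<sigma> where "\<sigma> = (1 + \<alpha>) / q"
  have \<sigma>q: "\<sigma> * q = 1 + \<alpha>" using q by (simp add: \<sigma>_def)
  obtain g where [measurable]: "g \<in> borel_measurable borel" and g: "\<And>z. Im z > 0 \<Longrightarrow> g z = f z"
    using holomorphic_borel_extension[OF f] by (auto simp: upper_half_plane_def open_halfspace_Im_gt)
  obtain \<psi> where [measurable]: "\<psi> \<in> borel_measurable borel" and \<psi>: "\<And>t. 0 \<le> \<psi> t"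
    "\<And>h :: real \<Rightarrow> real. (\<integral>\<^sup>+t. ennreal (h t * \<phi> t) \<partial>lebesgue_on {0<..}) = (\<integral>\<^sup>+t. ennreal (h t * \<psi> t) \<partial>lborel)"
    by (rule lebesgue_on_borel_representative[OF \<phi>]) (use nn in auto)
  define W where "W t = indicator {0<..} t * t powr (\<sigma> - 1) * \<psi> t" for t
  have [measurable]: "W \<in> borel_measurable borel" unfolding W_def by measurable
  have W: "0 \<le> W t" for t using \<psi>(1) by (simp add: W_def)
  have WK: "(\<integral>\<^sup>+t. ennreal (W t) \<partial>lborel) = ennreal K"
  proof -
    have "(\<integral>\<^sup>+t. ennreal (t powr (\<sigma> - 1) * \<phi> t) \<partial>lebesgue_on {0<..}) =
        (\<integral>\<^sup>+t. ennreal (indicator {0<..} t * t powr (\<sigma> - 1) * \<phi> t) \<partial>lebesgue_on {0<..})"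
      by (intro nn_integral_cong) simp
    then show ?thesis using K(1) unfolding W_def \<psi>(2) \<sigma>_def by simp
  qed
  \<comment> \<open>The power of t is split off so that the weight \<open>W\<close> has total mass
    exactly \<open>K\<close>, while each dilate in \<open>G\<close> has line integrals at most
    \<open>b powr q\<close>.\<close>
  define G where "G z t = t powr (-\<sigma>) * cmod (g (z / of_real t))" for z t
  have [measurable]: "(\<lambda>t. G z t) \<in> borel_measurable borel" for z unfolding G_def by measurable
  let ?\<Phi> = "\<lambda>x t. W t * G (Complex x y) t powr q"
  have ptw: "ennreal (cmod (hausdorff_op \<phi> f (Complex x y)) powr q) \<le>
      ennreal (K powr (q - 1)) * (\<integral>\<^sup>+t. ennreal (?\<Phi> x t) \<partial>lborel)" for x
  proof (rule weighted_power_mean)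
    let ?z = "Complex x y"
    have "integrable (lebesgue_on {0<..}) (hausdorff_integrand \<phi> f ?z)"
      using assms(9) y by (simp add: hausdorff_defined_def upper_half_plane_def)
    then have "ennreal (cmod (hausdorff_op \<phi> f ?z)) \<le>
        (\<integral>\<^sup>+t. ennreal (cmod (hausdorff_integrand \<phi> f ?z t)) \<partial>lebesgue_on {0<..})"
      unfolding hausdorff_op_def by (rule integral_norm_bound_ennreal)
    also have "\<dots> = (\<integral>\<^sup>+t. ennreal ((indicator {0<..} t * t powr (\<sigma> - 1) * G ?z t) * \<phi> t) \<partial>lebesgue_on {0<..})"
    proof (intro nn_integral_cong arg_cong[of _ _ ennreal])
      fix t :: real assume "t \<in> space (lebesgue_on {0<..})"
      then have t: "0 < t" by simp
      have "t powr (\<sigma> - 1) * t powr (-\<sigma>) = 1 / t"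
        using t by (simp add: powr_diff powr_minus field_simps)
      then have "(t powr (\<sigma> - 1) * t powr (-\<sigma>)) * (cmod (f (?z / of_real t)) * \<phi> t) =
          1 / t * (cmod (f (?z / of_real t)) * \<phi> t)" by simp
      then show "cmod (hausdorff_integrand \<phi> f ?z t) = indicator {0<..} t * t powr (\<sigma> - 1) * G ?z t * \<phi> t"
        using t y nn[OF t] by (simp add: hausdorff_integrand_def G_def g norm_mult norm_divide mult_ac)
    qed
    also have "\<dots> = (\<integral>\<^sup>+t. ennreal (W t * G ?z t) \<partial>lborel)"
      unfolding \<psi>(2) W_def by (simp add: mult_ac)
    finally show "ennreal (cmod (hausdorff_op \<phi> f ?z)) \<le> \<dots>" .
  qed (use W WK K q in \<open>auto simp: G_def\<close>)
  have [measurable]: "(\<lambda>(x, t). G (Complex x y) t) \<in> borel_measurable (lborel \<Otimes>\<^sub>M lborel)"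
    unfolding G_def by measurable
  have "line_integral q \<alpha> (hausdorff_op \<phi> f) y \<le>
     (\<integral>\<^sup>+x. \<integral>\<^sup>+t. ennreal (K powr (q - 1)) * ennreal (?\<Phi> x t * \<bar>x\<bar> powr \<alpha>) \<partial>lborel \<partial>lborel)"
  proof (intro nn_integral_mono)
    fix x
    have "ennreal (cmod (hausdorff_op \<phi> f (Complex x y)) powr q * \<bar>x\<bar> powr \<alpha>) \<le>
       ennreal (K powr (q - 1)) * (\<integral>\<^sup>+t. ennreal (?\<Phi> x t) \<partial>lborel) * ennreal (\<bar>x\<bar> powr \<alpha>)"
      by (subst ennreal_mult) (auto intro!: mult_right_mono ptw)
    also have "\<dots> = ennreal (K powr (q - 1)) * (\<integral>\<^sup>+t. ennreal (?\<Phi> x t * \<bar>x\<bar> powr \<alpha>) \<partial>lborel)"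
      using W by (simp add: mult.assoc nn_integral_multc[symmetric] ennreal_mult[symmetric])
    also have "\<dots> = (\<integral>\<^sup>+t. ennreal (K powr (q - 1)) * ennreal (?\<Phi> x t * \<bar>x\<bar> powr \<alpha>) \<partial>lborel)"
      by (rule nn_integral_cmult[symmetric]) measurable
    finally show "ennreal (cmod (hausdorff_op \<phi> f (Complex x y)) powr q * \<bar>x\<bar> powr \<alpha>) \<le> \<dots>" .
  qed
  also have "\<dots> = (\<integral>\<^sup>+t. \<integral>\<^sup>+x. ennreal (K powr (q - 1)) * ennreal (?\<Phi> x t * \<bar>x\<bar> powr \<alpha>) \<partial>lborel \<partial>lborel)"
    by (rule lborel_pair.Fubini') measurable
  also have "\<dots> \<le> (\<integral>\<^sup>+t. ennreal (K powr (q - 1) * b powr q) * ennreal (W t) \<partial>lborel)"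
  proof (intro nn_integral_mono)
    fix t :: real
    show "(\<integral>\<^sup>+x. ennreal (K powr (q - 1)) * ennreal (?\<Phi> x t * \<bar>x\<bar> powr \<alpha>) \<partial>lborel) \<le>
        ennreal (K powr (q - 1) * b powr q) * ennreal (W t)"
    proof (cases "0 < t")
      case t: True
      define c where "c = K powr (q - 1) * (W t * t powr (- (1 + \<alpha>)))"
      have c: "0 \<le> c" using W by (simp add: c_def)
      have "(\<integral>\<^sup>+x. ennreal (K powr (q - 1)) * ennreal (?\<Phi> x t * \<bar>x\<bar> powr \<alpha>) \<partial>lborel) =
         (\<integral>\<^sup>+x. ennreal c * ennreal (cmod (g (Complex x y / of_real t)) powr q * \<bar>x\<bar> powr \<alpha>) \<partial>lborel)"
        using W t by (intro nn_integral_cong)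
          (simp add: c_def G_def ennreal_mult[symmetric] powr_mult powr_powr \<sigma>q mult_ac del: minus_add_distrib)
      also have "\<dots> = ennreal c * line_integral q \<alpha> (\<lambda>z. g (z / of_real t)) y"
        by (rule nn_integral_cmult) measurable
      also have "\<dots> = ennreal c * (ennreal (t powr (1 + \<alpha>)) * line_integral q \<alpha> f (y / t))"
        using y t by (subst line_integral_dilation) (simp_all add: g)
      also have "\<dots> \<le> ennreal c * (ennreal (t powr (1 + \<alpha>)) * ennreal (b powr q))"
        by (intro mult_left_mono b) (use y t in auto)
      also have "\<dots> = ennreal (K powr (q - 1) * b powr q) * ennreal (W t)"
      proof -
        have "t powr (- (1 + \<alpha>)) * t powr (1 + \<alpha>) = 1"
          unfolding powr_add[symmetric] using t by simp
        then have "c * (t powr (1 + \<alpha>) * b powr q) = K powr (q - 1) * b powr q * W t"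
          by (simp add: c_def)
        then show ?thesis using c W by (simp add: ennreal_mult[symmetric])
      qed
      finally show ?thesis .
    qed (simp add: W_def)
  qed
  also have "\<dots> = ennreal (K powr (q - 1) * b powr q) * ennreal K"
    by (simp add: nn_integral_cmult WK)
  also have "\<dots> = ennreal ((K * b) powr q)"
  proof (cases "K = 0")
    case False
    then have "K powr (q - 1) * K = K powr q"
      using K powr_add[of K "q - 1" 1] by simp
    then show ?thesis using K b by (simp add: ennreal_mult[symmetric] powr_mult mult_ac)
  qed (use q in simp)
  finally show ?thesis .
qed

lemma hausdorff_op_finite_exponent:
  assumes q: "1 \<le> q" and f: "f holomorphic_on upper_half_plane" and \<phi>: "\<phi> \<in> borel_measurable (lebesgue_on {0<..})"
    and nn: "\<And>t. t > 0 \<Longrightarrow> \<phi> t \<ge> 0"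
    and K: "(\<integral>\<^sup>+t. ennreal (t powr ((1 + \<alpha>) / q - 1) * \<phi> t) \<partial>lebesgue_on {0<..}) < \<infinity>"
    and b: "\<And>y. 0 < y \<Longrightarrow> line_integral q \<alpha> f y \<le> ennreal (b powr q)"
  shows "hausdorff_defined \<phi> f" "hausdorff_op \<phi> f holomorphic_on upper_half_plane"
proof -
  define \<sigma> where "\<sigma> = (1 + \<alpha>) / q"
  have \<sigma>q: "\<sigma> * q = 1 + \<alpha>" using q by (simp add: \<sigma>_def)
  obtain g where [measurable]: "g \<in> borel_measurable borel" and g: "\<And>z. Im z > 0 \<Longrightarrow> g z = f z"
    using holomorphic_borel_extension[OF f] by (auto simp: upper_half_plane_def open_halfspace_Im_gt)
  have dom: "\<exists>r>0. \<exists>C. ball z0 r \<subseteq> upper_half_plane \<and>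
      (\<forall>z\<in>ball z0 r. \<forall>t>0. cmod (f (z / of_real t)) \<le> C * t powr \<sigma>)" if z0: "z0 \<in> upper_half_plane" for z0
  proof -
    have Im0: "0 < Im z0" using z0 by (simp add: upper_half_plane_def)
    obtain C where C: "\<And>f w. f holomorphic_on {z. Im z > 0} \<Longrightarrow>
      (\<And>y. 0 < y \<Longrightarrow> line_integral q \<alpha> f y \<le> ennreal (b powr q)) \<Longrightarrow>
      w \<in> ball z0 (Im z0 / 4) \<Longrightarrow> cmod (f w) \<le> C"
      by (rule weighted_Hardy_locally_bounded[OF q Im0, of "b powr q" \<alpha>]) auto
    have "cmod (f (z / of_real t)) \<le> C * t powr \<sigma>" if z: "z \<in> ball z0 (Im z0 / 4)" and t: "0 < t" for z t
    proof -
      \<comment> \<open>This normalised dilate has the same line integral bound as \<open>f\<close>,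
        since \<sigma> * q = 1 + \<alpha>. Evaluating it at \<open>z\<close>, which stays in a fixed
        ball, replaces evaluating \<open>f\<close> at the moving point \<open>z / t\<close>.\<close>
      define F where "F z = of_real (t powr (-\<sigma>)) * f (z / of_real t)" for z
      have "cmod (F z) \<le> C"
      proof (rule C[OF _ _ z])
        have "(f \<circ> (\<lambda>z. z / of_real t)) holomorphic_on {z. Im z > 0}"
          by (rule holomorphic_on_compose_gen[OF _ f]) (use t in \<open>auto simp: upper_half_plane_def intro!: holomorphic_intros\<close>)
        then show "F holomorphic_on {z. Im z > 0}"
          unfolding F_def comp_def by (intro holomorphic_intros)
        fix y :: real assume y: "0 < y"
        have "line_integral q \<alpha> F y = (\<integral>\<^sup>+x. ennreal (t powr (- (1 + \<alpha>))) *
            ennreal (cmod (g (Complex x y / of_real t)) powr q * \<bar>x\<bar> powr \<alpha>) \<partial>lborel)"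
          using t y by (intro nn_integral_cong)
            (simp add: F_def g norm_mult ennreal_mult[symmetric] powr_mult powr_powr \<sigma>q mult_ac del: minus_add_distrib)
        also have "\<dots> = ennreal (t powr (- (1 + \<alpha>))) * line_integral q \<alpha> (\<lambda>z. g (z / of_real t)) y"
          by (rule nn_integral_cmult) measurable
        also have "\<dots> = ennreal (t powr (- (1 + \<alpha>))) * (ennreal (t powr (1 + \<alpha>)) * line_integral q \<alpha> f (y / t))"
          using y t by (subst line_integral_dilation) (simp_all add: g)
        also have "\<dots> = line_integral q \<alpha> f (y / t)"
          using t by (simp add: mult.assoc[symmetric] ennreal_mult[symmetric] powr_add[symmetric])
        also have "\<dots> \<le> ennreal (b powr q)" using y t by (intro b) auto
        finally show "line_integral q \<alpha> F y \<le> ennreal (b powr q)" .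
      qed
      then have "cmod (f (z / of_real t)) * t powr (-\<sigma>) \<le> C" by (simp add: F_def norm_mult mult.commute)
      then show ?thesis using t by (simp add: powr_minus divide_simps)
    qed
    moreover have "ball z0 (Im z0 / 4) \<subseteq> upper_half_plane"
    proof
      fix z assume "z \<in> ball z0 (Im z0 / 4)"
      then show "z \<in> upper_half_plane"
        using abs_Im_le_cmod[of "z0 - z"] Im0 by (auto simp: dist_norm upper_half_plane_def)
    qed
    ultimately show ?thesis using Im0 by (intro exI[of _ "Im z0 / 4"] conjI exI[of _ C]) auto
  qed
  show "hausdorff_defined \<phi> f" "hausdorff_op \<phi> f holomorphic_on upper_half_plane"
    by (rule hausdorff_op_holomorphic[OF f \<phi> _ K[folded \<sigma>_def]], erule nn, erule dom)+
qed

section \<open>Test functions\<close>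

text \<open>The modulus behaves like |z| to the power \<epsilon> - \<sigma> near 0 and to the power
  - \<epsilon> - \<sigma> at infinity, a perturbation of the critical power - \<sigma> that is
  symmetric under inversion. Writing the powers as exponentials makes the function non-zero
  everywhere by construction.\<close>

definition test_function :: "real \<Rightarrow> real \<Rightarrow> complex \<Rightarrow> complex" where
  "test_function \<sigma> \<epsilon> z = exp (of_real (\<epsilon> - \<sigma>) * Ln z) * exp (of_real (- 2 * \<epsilon>) * Ln (1 - \<i> * z))"

lemma cmod_exp_of_real_Ln: "z \<noteq> 0 \<Longrightarrow> cmod (exp (of_real a * Ln z)) = cmod z powr a"
  by (simp add: powr_def)

text \<open>\<open>1 - \<i> * z\<close> has real part 1 + Im z and imaginary part - Re z, so it
  avoids the branch cut and its modulus dominates both 1 and |x|.\<close>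

lemma one_minus_ii_times:
  assumes "0 < Im z"
  shows "0 < Re (1 - \<i> * z)" "1 - \<i> * z \<noteq> 0" "1 \<le> cmod (1 - \<i> * z)" "\<bar>Re z\<bar> \<le> cmod (1 - \<i> * z)"
proof -
  show *: "0 < Re (1 - \<i> * z)" using assms by simp
  show "1 - \<i> * z \<noteq> 0" using * by (metis less_irrefl zero_complex.sel(1))
  show "1 \<le> cmod (1 - \<i> * z)" using complex_Re_le_cmod[of "1 - \<i> * z"] assms by simp
  show "\<bar>Re z\<bar> \<le> cmod (1 - \<i> * z)" using abs_Im_le_cmod[of "1 - \<i> * z"] by simp
qed

lemma test_function_holomorphic: "test_function \<sigma> \<epsilon> holomorphic_on upper_half_plane"
proof -
  have "z \<notin> \<real>\<^sub>\<le>\<^sub>0" "1 - \<i> * z \<notin> \<real>\<^sub>\<le>\<^sub>0" if "z \<in> upper_half_plane" for z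
    using that one_minus_ii_times(1)[of z] by (auto simp: upper_half_plane_def complex_nonpos_Reals_iff)
  then show ?thesis
    unfolding test_function_def[abs_def] by (intro holomorphic_intros) auto
qed

lemma cmod_test_function:
  assumes "0 < Im z"
  shows "cmod (test_function \<sigma> \<epsilon> z) = cmod z powr (\<epsilon> - \<sigma>) * cmod (1 - \<i> * z) powr (- 2 * \<epsilon>)"
proof -
  have "z \<noteq> 0" using assms by auto
  then show ?thesis
    unfolding test_function_def norm_mult
    using cmod_exp_of_real_Ln one_minus_ii_times(2)[OF assms] by presburger
qed

lemma test_function_nonzero: "test_function \<sigma> \<epsilon> z \<noteq> 0"
  by (simp add: test_function_def)

text \<open>Dividing by a positive \<open>t\<close> leaves the principal argument of
  \<open>z\<close> alone, so \<open>Ln\<close> splits without a branch correction and the first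
  factor is exactly homogeneous.\<close>

lemma test_function_dilation:
  assumes "0 < Im z" "0 < t"
  shows "test_function \<sigma> \<epsilon> (z / of_real t) =
    exp (of_real (\<epsilon> - \<sigma>) * Ln z) * of_real (t powr (\<sigma> - \<epsilon>)) *
    exp (of_real (- 2 * \<epsilon>) * Ln (1 - \<i> * (z / of_real t)))"
proof -
  have z: "z \<noteq> 0" using assms by auto
  have "Ln (z / of_real t) = Ln (of_real (1 / t) * z)" by simp
  also have "\<dots> = of_real (ln (1 / t)) + Ln z"
    using Ln_times_of_real[of "1 / t" z] Ln_of_real[of "1 / t"] assms z by simp
  finally have L: "Ln (z / of_real t) = Ln z - of_real (ln t)"
    using assms by (simp add: ln_div)
  have "exp (of_real (\<epsilon> - \<sigma>) * Ln (z / of_real t)) =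
      exp (of_real (\<epsilon> - \<sigma>) * Ln z) * exp (of_real ((\<sigma> - \<epsilon>) * ln t))"
    unfolding L by (simp add: exp_add[symmetric] algebra_simps)
  also have "exp (of_real ((\<sigma> - \<epsilon>) * ln t)) = (of_real (t powr (\<sigma> - \<epsilon>)) :: complex)"
    unfolding exp_of_real using assms by (simp add: powr_def)
  finally show ?thesis by (simp add: test_function_def)
qed

text \<open>Along a ray, only the second factor changes its argument, and by at most \<open>\<pi> * \<epsilon>\<close>.\<close>

lemma Re_test_function_ge:
  assumes z: "0 < Im z" and t: "0 < t" and \<epsilon>: "0 < \<epsilon>" "\<epsilon> < 1/2"
    and c: "c = exp (of_real (\<epsilon> - \<sigma>) * Ln z)"
  shows "cos (pi * \<epsilon>) * cmod (test_function \<sigma> \<epsilon> (z / of_real t)) \<le> cmod c * Re (test_function \<sigma> \<epsilon> (z / of_real t) / c)"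
proof -
  define w where "w = 1 - \<i> * (z / of_real t)"
  have w: "0 < Re w" "w \<noteq> 0"
    using one_minus_ii_times[of "z / of_real t"] z t unfolding w_def by auto
  define r where "r = t powr (\<sigma> - \<epsilon>)"
  have r: "0 \<le> r" by (simp add: r_def)
  have f: "test_function \<sigma> \<epsilon> (z / of_real t) = c * of_real r * exp (of_real (- 2 * \<epsilon>) * Ln w)"
    unfolding c r_def w_def by (rule test_function_dilation[OF z t])
  have c0: "c \<noteq> 0" unfolding c by simp
  \<comment> \<open>The absolute value moves the angle into [0, pi], where cosine decreases;
    evenness of cosine undoes the change of sign.\<close>
  define \<theta> where "\<theta> = 2 * \<epsilon> * \<bar>Im (Ln w)\<bar>"
  have "\<bar>Im (Ln w)\<bar> < pi / 2" using Re_Ln_pos_lt[OF w(2)] w(1) by simp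
  then have "2 * \<epsilon> * \<bar>Im (Ln w)\<bar> \<le> 2 * \<epsilon> * (pi / 2)"
    using \<epsilon> by (intro mult_left_mono) auto
  then have \<theta>: "0 \<le> \<theta>" "\<theta> \<le> pi * \<epsilon>" using \<epsilon> by (auto simp: \<theta>_def mult.commute)
  have "pi * \<epsilon> \<le> pi" using \<epsilon> by simp
  then have cos: "cos (pi * \<epsilon>) \<le> cos \<theta>" using \<theta> by (intro cos_monotone_0_pi_le) auto
  have "cos \<theta> = cos (\<bar>- 2 * \<epsilon> * Im (Ln w)\<bar>)"
    using \<epsilon> by (simp add: \<theta>_def abs_mult)
  then have cos2: "cos \<theta> = cos (- 2 * \<epsilon> * Im (Ln w))" by (simp only: cos_abs_real)
  have Re: "Re (exp (of_real (- 2 * \<epsilon>) * Ln w)) = cmod w powr (- 2 * \<epsilon>) * cos \<theta>"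
    unfolding cos2 Re_exp using w by (simp add: powr_def)
  have "Re (test_function \<sigma> \<epsilon> (z / of_real t) / c) = r * (cmod w powr (- 2 * \<epsilon>) * cos \<theta>)"
  proof -
    have "test_function \<sigma> \<epsilon> (z / of_real t) / c = of_real r * exp (of_real (- 2 * \<epsilon>) * Ln w)"
      unfolding f using c0 by simp
    then show ?thesis using Re by (simp only: Re_complex_of_real Im_complex_of_real times_complex.sel)
  qed
  moreover have "cmod (test_function \<sigma> \<epsilon> (z / of_real t)) = cmod c * r * cmod w powr (- 2 * \<epsilon>)"
    unfolding f norm_mult cmod_exp_of_real_Ln[OF w(2)] using r by simp
  moreover have "cmod c * r * cmod w powr (- 2 * \<epsilon>) * cos (pi * \<epsilon>) \<le> cmod c * r * cmod w powr (- 2 * \<epsilon>) * cos \<theta>"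
    using cos r by (intro mult_left_mono) auto
  ultimately show ?thesis by (simp add: mult_ac)
qed

text \<open>Comparing real and imaginary parts gives |1 - i z / t| <= max 1 (1 / t) * |1 - i z|. For
  t >= 1 the loss is \<open>t powr (- \<epsilon>)\<close>, from the homogeneous factor alone. For t
  < 1 the second factor turns the gain \<open>t powr (- \<epsilon>)\<close> into a loss
  \<open>t powr \<epsilon>\<close>. For each fixed \<open>t\<close> the loss disappears as
  \<epsilon> tends to 0.\<close>

lemma cmod_test_function_dilation_ge:
  assumes z: "0 < Im z" and t: "0 < t" and \<epsilon>: "0 < \<epsilon>"
  shows "t powr \<sigma> * min t (1 / t) powr \<epsilon> * cmod (test_function \<sigma> \<epsilon> z) \<le> cmod (test_function \<sigma> \<epsilon> (z / of_real t))"
proof -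
  define w where "w = 1 - \<i> * (z / of_real t)"
  have z': "0 < Im (z / of_real t)" using z t by simp
  note w = one_minus_ii_times(2,3)[OF z', folded w_def]
  define M where "M = max 1 (1 / t)"
  have M: "1 \<le> M" by (simp add: M_def)
  have "cmod w \<le> M * cmod (1 - \<i> * z)"
  proof -
    have t1: "1 / t \<le> M" by (simp add: M_def)
    have re: "\<bar>Re w\<bar> \<le> \<bar>M * Re (1 - \<i> * z)\<bar>"
      using z t M mult_right_mono[OF t1, of "Im z"] by (simp add: w_def distrib_left abs_mult)
    have im: "\<bar>Im w\<bar> \<le> \<bar>M * Im (1 - \<i> * z)\<bar>"
      using z t M mult_right_mono[OF t1, of "\<bar>Re z\<bar>"] by (simp add: w_def abs_mult)
    have "cmod w \<le> cmod (of_real M * (1 - \<i> * z))"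
      unfolding cmod_def using re im
      by (intro real_sqrt_le_mono add_mono) (simp_all add: abs_le_square_iff)
    then show ?thesis using M by (simp add: norm_mult)
  qed
  then have "(M * cmod (1 - \<i> * z)) powr (- 2 * \<epsilon>) \<le> cmod w powr (- 2 * \<epsilon>)"
    using w \<epsilon> by (intro powr_mono2') auto
  then have 1: "M powr (- 2 * \<epsilon>) * cmod (1 - \<i> * z) powr (- 2 * \<epsilon>) \<le> cmod w powr (- 2 * \<epsilon>)"
    using M by (simp add: powr_mult)
  have 2: "t powr (\<sigma> - \<epsilon>) * M powr (- 2 * \<epsilon>) = t powr \<sigma> * min t (1 / t) powr \<epsilon>"
  proof (cases "1 \<le> t")
    case True
    then have "1 / t \<le> t" by (simp add: divide_le_eq mult_le_one order_trans[OF _ mult_mono, of 1 1 1])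
    then have "min t (1 / t) = 1 / t" "M = 1" using True by (auto simp: M_def)
    then show ?thesis using True by (simp add: powr_diff powr_divide)
  next
    case False
    have "1 / t \<ge> 1" using False t by simp
    then have "M = 1 / t" "min t (1 / t) = t" using False by (auto simp: M_def)
    moreover have "(1 / t) powr (- 2 * \<epsilon>) = t powr (2 * \<epsilon>)" using t by (simp add: powr_divide powr_minus)
    moreover have "t powr (\<sigma> - \<epsilon>) * t powr (2 * \<epsilon>) = t powr \<sigma> * t powr \<epsilon>"
      unfolding powr_add[symmetric] by (simp add: add.commute)
    ultimately show ?thesis by simp
  qed
  have "cmod (z / of_real t) powr (\<epsilon> - \<sigma>) = t powr (\<sigma> - \<epsilon>) * cmod z powr (\<epsilon> - \<sigma>)"
    using t by (simp add: norm_divide powr_divide powr_diff field_simps)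
  then have "cmod (test_function \<sigma> \<epsilon> (z / of_real t)) =
      t powr (\<sigma> - \<epsilon>) * cmod z powr (\<epsilon> - \<sigma>) * cmod w powr (- 2 * \<epsilon>)"
    by (simp add: cmod_test_function[OF z'] w_def)
  also have "\<dots> \<ge> t powr (\<sigma> - \<epsilon>) * cmod z powr (\<epsilon> - \<sigma>) * (M powr (- 2 * \<epsilon>) * cmod (1 - \<i> * z) powr (- 2 * \<epsilon>))"
    by (intro mult_left_mono 1) auto
  also have "t powr (\<sigma> - \<epsilon>) * cmod z powr (\<epsilon> - \<sigma>) * (M powr (- 2 * \<epsilon>) * cmod (1 - \<i> * z) powr (- 2 * \<epsilon>)) =
      (t powr (\<sigma> - \<epsilon>) * M powr (- 2 * \<epsilon>)) * (cmod z powr (\<epsilon> - \<sigma>) * cmod (1 - \<i> * z) powr (- 2 * \<epsilon>))"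
    by (simp only: mult_ac)
  finally show ?thesis unfolding 2 cmod_test_function[OF z] .
qed

text \<open>With \<delta> = \<epsilon> * q this is the majorant of the test function's integrand on
  all horizontal lines: exponent \<delta> - 1 near 0 and - \<delta> - 1 at infinity, each on the
  convergent side of -1.\<close>

lemma nn_integral_two_sided_power_finite:
  fixes \<delta> :: real
  assumes "0 < \<delta>"
  shows "(\<integral>\<^sup>+x. ennreal (\<bar>x\<bar> powr (\<delta> - 1) * max 1 \<bar>x\<bar> powr (- 2 * \<delta>)) \<partial>lborel) < \<infinity>"
proof -
  \<comment> \<open>\<open>u\<close> majorises on the positive half-line only; the negative half is
    handled by reflection.\<close>
  define u where "u x = ennreal (indicator {0..1} x * x powr (\<delta> - 1)) + ennreal (indicator {1..} x * x powr (- \<delta> - 1))" for x :: real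
  have [measurable]: "u \<in> borel_measurable borel" unfolding u_def by measurable
  have "(\<integral>\<^sup>+x. ennreal (indicator {0..1} x * x powr (\<delta> - 1)) \<partial>lborel) = ennreal (1 powr (\<delta> - 1 + 1) / (\<delta> - 1 + 1))"
    using has_integral_powr_from_0[of "\<delta> - 1" 1] assms
    by (intro nn_integral_has_integral_lebesgue) auto
  moreover have "(\<integral>\<^sup>+x. ennreal (indicator {1..} x * x powr (- \<delta> - 1)) \<partial>lborel) = ennreal (- (1 powr (- \<delta> - 1 + 1)) / (- \<delta> - 1 + 1))"
    using has_integral_powr_to_inf[of "- \<delta> - 1" 1] assms
    by (intro nn_integral_has_integral_lebesgue) auto
  ultimately have fin: "(\<integral>\<^sup>+x. u x \<partial>lborel) < \<infinity>"
    unfolding u_def by (subst nn_integral_add) auto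
  have sym: "(\<integral>\<^sup>+x. u (- x) \<partial>lborel) = (\<integral>\<^sup>+x. u x \<partial>lborel)"
    using nn_integral_real_affine[of u "-1" 0] by simp
  have "(\<integral>\<^sup>+x. ennreal (\<bar>x\<bar> powr (\<delta> - 1) * max 1 \<bar>x\<bar> powr (- 2 * \<delta>)) \<partial>lborel) \<le> (\<integral>\<^sup>+x. u x + u (- x) \<partial>lborel)"
  proof (intro nn_integral_mono)
    fix x :: real
    have "ennreal (\<bar>x\<bar> powr (\<delta> - 1) * max 1 \<bar>x\<bar> powr (- 2 * \<delta>)) \<le> u \<bar>x\<bar>"
    proof (cases "\<bar>x\<bar> \<le> 1")
      case False
      then have "\<bar>x\<bar> powr (\<delta> - 1) * max 1 \<bar>x\<bar> powr (- 2 * \<delta>) = \<bar>x\<bar> powr (- \<delta> - 1)"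
        by (simp add: max_def powr_add[symmetric])
      then show ?thesis using False by (simp add: u_def)
    qed (simp add: u_def max_def)
    also have "u \<bar>x\<bar> \<le> u x + u (- x)" by (cases "0 \<le> x") auto
    finally show "ennreal (\<bar>x\<bar> powr (\<delta> - 1) * max 1 \<bar>x\<bar> powr (- 2 * \<delta>)) \<le> u x + u (- x)" .
  qed
  also have "\<dots> = (\<integral>\<^sup>+x. u x \<partial>lborel) + (\<integral>\<^sup>+x. u x \<partial>lborel)"
    by (subst nn_integral_add) (simp_all add: sym)
  also have "\<dots> < \<infinity>" using fin by (simp add: less_top[symmetric])
  finally show ?thesis .
qed

text \<open>The bound is uniform in \<open>y\<close> because |z| >= |x| and |1 - i z| >= max 1 |x|,
  while both exponents are nonpositive; for the first of them this is the condition \<epsilon> <=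
  \<sigma>.\<close>

lemma line_integral_test_function_le:
  assumes "1 \<le> q" "0 < \<epsilon>" "\<epsilon> \<le> \<sigma>" "\<sigma> * q = 1 + \<alpha>" "0 < y"
  shows "line_integral q \<alpha> (test_function \<sigma> \<epsilon>) y \<le>
    (\<integral>\<^sup>+x. ennreal (\<bar>x\<bar> powr (\<epsilon> * q - 1) * max 1 \<bar>x\<bar> powr (- 2 * (\<epsilon> * q))) \<partial>lborel)"
proof (intro nn_integral_mono ennreal_leI)
  fix x :: real
  define z where "z = Complex x y"
  have z: "0 < Im z" using assms by (simp add: z_def)
  show "cmod (test_function \<sigma> \<epsilon> (Complex x y)) powr q * \<bar>x\<bar> powr \<alpha> \<le>
      \<bar>x\<bar> powr (\<epsilon> * q - 1) * max 1 \<bar>x\<bar> powr (- 2 * (\<epsilon> * q))"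
  proof (cases "x = 0")
    case False
    have "cmod z powr (\<epsilon> - \<sigma>) \<le> \<bar>x\<bar> powr (\<epsilon> - \<sigma>)"
      using assms False abs_Re_le_cmod[of z] by (intro powr_mono2') (auto simp: z_def)
    moreover have "cmod (1 - \<i> * z) powr (- 2 * \<epsilon>) \<le> max 1 \<bar>x\<bar> powr (- 2 * \<epsilon>)"
      using assms one_minus_ii_times(3,4)[OF z] by (intro powr_mono2') (auto simp: z_def)
    ultimately have "cmod (test_function \<sigma> \<epsilon> z) \<le> \<bar>x\<bar> powr (\<epsilon> - \<sigma>) * max 1 \<bar>x\<bar> powr (- 2 * \<epsilon>)"
      unfolding cmod_test_function[OF z] by (intro mult_mono) auto
    then have "cmod (test_function \<sigma> \<epsilon> z) powr q * \<bar>x\<bar> powr \<alpha> \<le>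
        (\<bar>x\<bar> powr (\<epsilon> - \<sigma>) * max 1 \<bar>x\<bar> powr (- 2 * \<epsilon>)) powr q * \<bar>x\<bar> powr \<alpha>"
      using assms by (intro mult_right_mono powr_mono2) auto
    also have "\<dots> = (\<bar>x\<bar> powr ((\<epsilon> - \<sigma>) * q) * \<bar>x\<bar> powr \<alpha>) * max 1 \<bar>x\<bar> powr (- 2 * (\<epsilon> * q))"
      by (simp add: powr_mult powr_powr mult_ac)
    also have "\<bar>x\<bar> powr ((\<epsilon> - \<sigma>) * q) * \<bar>x\<bar> powr \<alpha> = \<bar>x\<bar> powr (\<epsilon> * q - 1)"
      unfolding powr_add[symmetric] using assms by (simp add: left_diff_distrib)
    finally show ?thesis by (simp add: z_def)
  qed auto
qed

section \<open>The lower bound and the norm formula\<close>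

lemma hausdorff_op_cmult: "hausdorff_op \<phi> (\<lambda>z. a * f z) z = a * hausdorff_op \<phi> f z"
  unfolding hausdorff_op_def hausdorff_integrand_def mult.assoc by (rule integral_mult_right_zero)

text \<open>After division by the common phase factor \<open>c\<close>, every value of the integrand
  lies in a narrow sector about the positive axis. The real part of the integral therefore already
  captures the full size. The estimate lives in \<open>ennreal\<close>, since the integral on the
  left is not yet known to be finite.\<close>

lemma hausdorff_op_test_function_ge:
  assumes int: "integrable (lebesgue_on {0<..}) (hausdorff_integrand \<phi> (test_function \<sigma> \<epsilon>) z)"
    and nn: "\<And>t. t > 0 \<Longrightarrow> \<phi> t \<ge> 0" and z: "0 < Im z" and \<epsilon>: "0 < \<epsilon>" "\<epsilon> < 1/2"
    and \<phi>: "\<phi> \<in> borel_measurable (lebesgue_on {0<..})"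
  shows "(\<integral>\<^sup>+t. ennreal (cos (pi * \<epsilon>) * min t (1 / t) powr \<epsilon> * (t powr (\<sigma> - 1) * \<phi> t)) \<partial>lebesgue_on {0<..}) *
      ennreal (cmod (test_function \<sigma> \<epsilon> z)) \<le> ennreal (cmod (hausdorff_op \<phi> (test_function \<sigma> \<epsilon>) z))"
proof -
  let ?M = "lebesgue_on {0<..} :: real measure"
  let ?f = "test_function \<sigma> \<epsilon>"
  define c where "c = exp (of_real (\<epsilon> - \<sigma>) * Ln z)"
  have c0: "c \<noteq> 0" by (simp add: c_def)
  have "pi * \<epsilon> < pi * (1 / 2)" using \<epsilon> by (intro mult_strict_left_mono) auto
  moreover have "0 \<le> pi * \<epsilon>" using \<epsilon> by simp
  ultimately have cos: "0 \<le> cos (pi * \<epsilon>)" by (intro cos_ge_zero) linarith+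
  \<comment> \<open>Division by \<open>c\<close> removes the rotation but also the modulus, which
    the factor \<open>cmod c\<close> puts back.\<close>
  define h where "h t = cmod c * Re (hausdorff_integrand \<phi> ?f z t / c)" for t
  have int_c: "integrable ?M (\<lambda>t. hausdorff_integrand \<phi> ?f z t / c)"
    using int by simp
  then have inth: "integrable ?M h"
    unfolding h_def by (intro integrable_mult_right integrable_Re)
  have hge: "cos (pi * \<epsilon>) * min t (1 / t) powr \<epsilon> * (t powr (\<sigma> - 1) * \<phi> t) * cmod (?f z) \<le> h t" if t: "0 < t" for t
  proof -
    have \<phi>t: "0 \<le> \<phi> t / t" using nn[OF t] t by simp
    have tp: "t powr (\<sigma> - 1) * \<phi> t = t powr \<sigma> * (\<phi> t / t)" using t by (simp add: powr_diff)
    have "cos (pi * \<epsilon>) * (t powr \<sigma> * min t (1 / t) powr \<epsilon> * cmod (?f z)) \<le> cos (pi * \<epsilon>) * cmod (?f (z / of_real t))"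
      by (intro mult_left_mono cmod_test_function_dilation_ge z t \<epsilon> cos)
    also have "\<dots> \<le> cmod c * Re (?f (z / of_real t) / c)"
      by (rule Re_test_function_ge[OF z t \<epsilon> c_def])
    finally have le: "cos (pi * \<epsilon>) * (t powr \<sigma> * min t (1 / t) powr \<epsilon> * cmod (?f z)) * (\<phi> t / t) \<le>
        cmod c * Re (?f (z / of_real t) / c) * (\<phi> t / t)"
      using \<phi>t by (intro mult_right_mono)
    have "Re (?f (z / of_real t) / c) * (\<phi> t / t) = Re (?f (z / of_real t) / c * of_real (\<phi> t / t))"
      by (simp only: times_complex.sel Re_complex_of_real Im_complex_of_real mult_zero_right diff_zero)
    also have "?f (z / of_real t) / c * of_real (\<phi> t / t) = hausdorff_integrand \<phi> ?f z t / c"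
      by (simp add: hausdorff_integrand_def mult.commute)
    finally have "cmod c * Re (?f (z / of_real t) / c) * (\<phi> t / t) = h t"
      unfolding h_def mult.assoc by simp
    with le have "cos (pi * \<epsilon>) * (t powr \<sigma> * min t (1 / t) powr \<epsilon> * cmod (?f z)) * (\<phi> t / t) \<le> h t"
      by simp
    then show ?thesis unfolding tp by (simp only: mult_ac)
  qed
  have hnn: "0 \<le> h t" if "0 < t" for t
    using hge[OF that] cos nn[OF that] by (smt (verit) mult_nonneg_nonneg norm_ge_zero powr_ge_zero)
  let ?u = "\<lambda>t. cos (pi * \<epsilon>) * min t (1 / t) powr \<epsilon> * (t powr (\<sigma> - 1) * \<phi> t)"
  have idM: "(\<lambda>t::real. t) \<in> borel_measurable ?M"
    by (rule continuous_imp_measurable_on_sets_lebesgue) auto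
  have "(\<lambda>t. ennreal (?u t)) \<in> borel_measurable ?M" using idM \<phi> by measurable
  then have "(\<integral>\<^sup>+t. ennreal (?u t) \<partial>?M) * ennreal (cmod (?f z)) = (\<integral>\<^sup>+t. ennreal (?u t) * ennreal (cmod (?f z)) \<partial>?M)"
    by (rule nn_integral_multc[symmetric])
  also have "\<dots> \<le> (\<integral>\<^sup>+t. ennreal (h t) \<partial>?M)"
  proof (intro nn_integral_mono)
    fix t assume "t \<in> space ?M"
    then have t: "0 < t" by simp
    have "0 \<le> ?u t" using cos nn[OF t] by (intro mult_nonneg_nonneg) auto
    then show "ennreal (?u t) * ennreal (cmod (?f z)) \<le> ennreal (h t)"
      using hge[OF t] by (simp add: ennreal_mult[symmetric] ennreal_leI)
  qed
  also have "\<dots> = ennreal (integral\<^sup>L ?M h)"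
    using inth hnn by (intro nn_integral_eq_integral) (auto intro!: AE_I2)
  also have "integral\<^sup>L ?M h = cmod c * Re (hausdorff_op \<phi> ?f z / c)"
    unfolding h_def hausdorff_op_def using int_c by simp
  also have "ennreal \<dots> \<le> ennreal (cmod c * cmod (hausdorff_op \<phi> ?f z / c))"
    by (intro ennreal_leI mult_left_mono complex_Re_le_cmod) auto
  also have "cmod c * cmod (hausdorff_op \<phi> ?f z / c) = cmod (hausdorff_op \<phi> ?f z)"
    using c0 by (simp add: norm_divide)
  finally show ?thesis .
qed

section \<open>Norm comparison for the test functions\<close>

lemma test_function_in_hardy_space:
  assumes p: "1 \<le> p" "p \<noteq> \<infinity>" and \<alpha>: "\<alpha> > -1" and \<epsilon>: "0 < \<epsilon>" "\<epsilon> \<le> hardy_exponent p \<alpha>"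
  shows "test_function (hardy_exponent p \<alpha>) \<epsilon> \<in> hardy_space p \<alpha>"
proof -
  define q where "q = enn2real p"
  have q: "1 \<le> q" using p enn2real_mono[of 1 p] by (simp add: q_def less_top)
  have \<sigma>: "hardy_exponent p \<alpha> * q = 1 + \<alpha>" using p q by (simp add: hardy_exponent_def q_def)
  define D where "D = (\<integral>\<^sup>+x. ennreal (\<bar>x\<bar> powr (\<epsilon> * q - 1) * max 1 \<bar>x\<bar> powr (- 2 * (\<epsilon> * q))) \<partial>lborel)"
  have "D < \<infinity>" unfolding D_def by (rule nn_integral_two_sided_power_finite) (use \<epsilon> q in auto)
  then obtain d where d: "D = ennreal d" "0 \<le> d" by (cases D) auto
  have "hardy_norm p \<alpha> (test_function (hardy_exponent p \<alpha>) \<epsilon>) \<le> ennreal (d powr (1 / q))"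
    unfolding hardy_norm_le_iff[OF p powr_ge_zero] q_def[symmetric]
    using line_integral_test_function_le[OF q \<epsilon> \<sigma>] d q unfolding D_def by (simp add: powr_powr)
  then have "hardy_norm p \<alpha> (test_function (hardy_exponent p \<alpha>) \<epsilon>) < \<infinity>"
    by (rule order_le_less_trans) simp
  then show ?thesis
    by (simp add: hardy_space_def test_function_holomorphic)
qed

text \<open>The pointwise domination gives \<open>?\<kappa>\<close> * norm f <= norm of the image <=
  \<open>?A\<close> * norm f, and norm f is cancelled. The cancellation requires norm f to be finite
  and positive, and \<open>?\<kappa>\<close> to be finite.\<close>

lemma hardy_op_norm_ge_truncated:
  assumes p: "1 \<le> p" "p \<noteq> \<infinity>" and \<alpha>: "\<alpha> > -1" and \<phi>: "\<phi> \<in> borel_measurable (lebesgue_on {0<..})"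
    and nn: "\<And>t. t > 0 \<Longrightarrow> \<phi> t \<ge> 0" and bdd: "hausdorff_bounded p \<alpha> \<phi>"
    and \<epsilon>: "0 < \<epsilon>" "\<epsilon> < 1/2" "\<epsilon> \<le> hardy_exponent p \<alpha>"
  shows "(\<integral>\<^sup>+t. ennreal (cos (pi * \<epsilon>) * min t (1 / t) powr \<epsilon> * (t powr (hardy_exponent p \<alpha> - 1) * \<phi> t)) \<partial>lebesgue_on {0<..})
     \<le> hardy_op_norm p \<alpha> (hausdorff_op \<phi>)" (is "?\<kappa> \<le> ?A")
proof -
  define q where "q = enn2real p"
  have q: "1 \<le> q" using p enn2real_mono[of 1 p] by (simp add: q_def less_top)
  define f where "f = test_function (hardy_exponent p \<alpha>) \<epsilon>"
  have f: "f \<in> hardy_space p \<alpha>" unfolding f_def by (rule test_function_in_hardy_space[OF p \<alpha> \<epsilon>(1,3)])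
  have f0: "f z \<noteq> 0" for z by (simp add: f_def test_function_nonzero)
  have lower: "?\<kappa> * ennreal (cmod (f z)) \<le> ennreal (cmod (hausdorff_op \<phi> f z))" if "0 < Im z" for z
    unfolding f_def
  proof (rule hausdorff_op_test_function_ge[OF _ nn that \<epsilon>(1,2) \<phi>])
    show "integrable (lebesgue_on {0<..}) (hausdorff_integrand \<phi> (test_function (hardy_exponent p \<alpha>) \<epsilon>) z)"
      using bdd f that by (auto simp: hausdorff_bounded_def hausdorff_defined_def upper_half_plane_def f_def)
  qed
  \<comment> \<open>Boundedness makes the image finite at every point, so the lower bound at the
    single point \<i> already excludes an infinite constant.\<close>
  have "?\<kappa> \<noteq> \<infinity>"
  proof
    assume "?\<kappa> = \<infinity>"
    with lower[of \<i>] f0[of \<i>] show False by (simp add: ennreal_top_mult top_unique)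
  qed
  then obtain k where k: "?\<kappa> = ennreal k" "0 \<le> k" by (cases ?\<kappa>) auto
  have "?A < \<infinity>" using bdd by (simp add: hausdorff_bounded_def)
  then obtain A where A: "?A = ennreal A" "0 \<le> A" by (cases ?A) auto
  have "hardy_norm p \<alpha> f < \<infinity>" using f by (simp add: hardy_space_def)
  then obtain n where n: "hardy_norm p \<alpha> f = ennreal n" "0 \<le> n" by (cases "hardy_norm p \<alpha> f") auto
  have If: "line_integral q \<alpha> f y \<le> ennreal (b powr q)" if "n \<le> b" "0 < y" for y b
    using n that hardy_norm_le_iff[OF p, of b \<alpha> f] by (simp add: q_def ennreal_leI)
  \<comment> \<open>Norm zero would make the integrand on the line y = 1 vanish almost everywhere,
    but it is non-zero for every x other than 0.\<close>
  have n0: "0 < n"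
  proof (rule ccontr)
    assume "\<not> 0 < n"
    then have "n = 0" using n by simp
    then have "line_integral q \<alpha> f 1 = 0" using If[of 0 1] q by simp
    moreover have "(\<lambda>x. ennreal (cmod (f (Complex x 1)) powr q * \<bar>x\<bar> powr \<alpha>)) \<in> borel_measurable lborel"
    proof -
      have "f holomorphic_on upper_half_plane" using f by (simp add: hardy_space_def)
      then have "continuous_on UNIV (\<lambda>x. f (Complex x 1))"
        by (rule continuous_on_compose2[OF holomorphic_on_imp_continuous_on])
          (auto simp: upper_half_plane_def intro: continuous_intros)
      then have [measurable]: "(\<lambda>x. f (Complex x 1)) \<in> borel_measurable borel"
        by (rule borel_measurable_continuous_onI)
      show ?thesis by measurable
    qed
    ultimately have "AE x in lborel. ennreal (cmod (f (Complex x 1)) powr q * \<bar>x\<bar> powr \<alpha>) = 0"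
      by (simp add: nn_integral_0_iff_AE)
    then have "AE x in lborel. x = (0::real)"
      by (rule AE_mp) (intro AE_I2 impI, simp add: ennreal_eq_0_iff mult_le_0_iff f0)
    moreover have "AE x in lborel. x \<noteq> (0::real)" by (rule AE_lborel_singleton)
    ultimately have "AE x in (lborel :: real measure). False" by eventually_elim simp
    then show False by (simp add: eventually_False ae_filter_eq_bot_iff)
  qed
  \<comment> \<open>The operator norm is a supremum over the unit ball, so the test function is
    normalised first.\<close>
  define g where "g = (\<lambda>z. of_real (1 / n) * f z)"
  have g1: "hardy_norm p \<alpha> g \<le> 1"
  proof -
    have "line_integral q \<alpha> g y \<le> ennreal (1 powr q)" if y: "0 < y" for y
    proof -
      have "line_integral q \<alpha> g y \<le> ennreal ((1 / n) powr q) * line_integral q \<alpha> f y"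
      proof -
        obtain f' where [measurable]: "f' \<in> borel_measurable borel" and f': "\<And>z. 0 < Im z \<Longrightarrow> f' z = f z"
          using holomorphic_borel_extension[of f upper_half_plane] f
          by (auto simp: hardy_space_def upper_half_plane_def open_halfspace_Im_gt)
        have "line_integral q \<alpha> g y = (\<integral>\<^sup>+x. ennreal ((1 / n) powr q) * ennreal (cmod (f' (Complex x y)) powr q * \<bar>x\<bar> powr \<alpha>) \<partial>lborel)"
          using n0 y by (intro nn_integral_cong) (simp add: g_def f' norm_divide norm_mult powr_mult powr_divide ennreal_mult[symmetric])
        also have "\<dots> = ennreal ((1 / n) powr q) * line_integral q \<alpha> f' y"
          by (rule nn_integral_cmult) measurable
        finally show ?thesis using y by (simp add: f')
      qed
      also have "\<dots> \<le> ennreal ((1 / n) powr q) * ennreal (n powr q)"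
        by (intro mult_left_mono If) (use y in auto)
      also have "\<dots> = ennreal (1 powr q)"
        using n0 by (simp add: ennreal_mult[symmetric] powr_mult[symmetric] del: powr_one_eq_one)
      finally show ?thesis .
    qed
    then show ?thesis using hardy_norm_le_iff[OF p, of 1 \<alpha> g] by (simp add: q_def)
  qed
  have "g holomorphic_on upper_half_plane"
    using f unfolding g_def hardy_space_def by (intro holomorphic_intros) auto
  then have g: "g \<in> hardy_space p \<alpha>" using g1 order_le_less_trans[OF g1, of \<infinity>] by (simp add: hardy_space_def)
  have "hardy_norm p \<alpha> (hausdorff_op \<phi> g) \<le> ?A"
    unfolding hardy_op_norm_def using g g1 by (intro SUP_upper) auto
  then have IH: "line_integral q \<alpha> (hausdorff_op \<phi> g) y \<le> ennreal (A powr q)" if "0 < y" for y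
    using that A hardy_norm_le_iff[OF p, of A \<alpha> "hausdorff_op \<phi> g"] by (simp add: q_def)
  show ?thesis
  proof (cases "k = 0")
    case False
    then have k0: "0 < k" using k by simp
    \<comment> \<open>The domination is read backwards: a bound for the image bounds
      \<open>f\<close> itself, so that A * n / k becomes an upper bound for the norm
      \<open>n\<close>, and k <= A follows.\<close>
    have "line_integral q \<alpha> f y \<le> ennreal ((A * n / k) powr q)" if y: "0 < y" for y
    proof -
      have pt: "k / n * cmod (f (Complex x y)) \<le> cmod (hausdorff_op \<phi> g (Complex x y))" for x
      proof -
        have "k * cmod (f (Complex x y)) \<le> cmod (hausdorff_op \<phi> f (Complex x y))"
          using lower[of "Complex x y"] y k unfolding k(1) by (simp add: ennreal_mult[symmetric])
        then show ?thesis
          unfolding g_def hausdorff_op_cmult using n0 by (simp add: norm_mult norm_divide divide_right_mono)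
      qed
      obtain f' where [measurable]: "f' \<in> borel_measurable borel" and f': "\<And>z. 0 < Im z \<Longrightarrow> f' z = f z"
        using holomorphic_borel_extension[of f upper_half_plane] f
        by (auto simp: hardy_space_def upper_half_plane_def open_halfspace_Im_gt)
      have "ennreal ((k / n) powr q) * line_integral q \<alpha> f y = ennreal ((k / n) powr q) * line_integral q \<alpha> f' y"
        using y by (simp add: f')
      also have "\<dots> = (\<integral>\<^sup>+x. ennreal ((k / n) powr q) * ennreal (cmod (f' (Complex x y)) powr q * \<bar>x\<bar> powr \<alpha>) \<partial>lborel)"
        by (rule nn_integral_cmult[symmetric]) measurable
      also have "\<dots> \<le> line_integral q \<alpha> (hausdorff_op \<phi> g) y"
      proof (intro nn_integral_mono)
        fix x
        have "(k / n * cmod (f (Complex x y))) powr q \<le> cmod (hausdorff_op \<phi> g (Complex x y)) powr q"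
          using pt[of x] k0 n0 q by (intro powr_mono2) auto
        then have "(k / n) powr q * cmod (f (Complex x y)) powr q * \<bar>x\<bar> powr \<alpha> \<le> cmod (hausdorff_op \<phi> g (Complex x y)) powr q * \<bar>x\<bar> powr \<alpha>"
          by (subst powr_mult[symmetric]) (intro mult_right_mono, auto)
        then show "ennreal ((k / n) powr q) * ennreal (cmod (f' (Complex x y)) powr q * \<bar>x\<bar> powr \<alpha>) \<le>
            ennreal (cmod (hausdorff_op \<phi> g (Complex x y)) powr q * \<bar>x\<bar> powr \<alpha>)"
          using y by (simp add: f' ennreal_mult[symmetric] mult.assoc ennreal_leI)
      qed
      also have "\<dots> \<le> ennreal (A powr q)" by (rule IH[OF y])
      finally have *: "ennreal ((k / n) powr q) * line_integral q \<alpha> f y \<le> ennreal (A powr q)" .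
      have "line_integral q \<alpha> f y = ennreal ((n / k) powr q) * (ennreal ((k / n) powr q) * line_integral q \<alpha> f y)"
        using k0 n0 by (simp add: mult.assoc[symmetric] ennreal_mult[symmetric] powr_mult[symmetric])
      also have "\<dots> \<le> ennreal ((n / k) powr q) * ennreal (A powr q)"
        by (intro mult_left_mono *) auto
      also have "\<dots> = ennreal ((A * n / k) powr q)"
        using k0 n0 A by (simp add: ennreal_mult[symmetric] powr_mult powr_divide)
      finally show ?thesis .
    qed
    then have "hardy_norm p \<alpha> f \<le> ennreal (A * n / k)"
      using hardy_norm_le_iff[OF p, of "A * n / k" \<alpha> f] k0 n0 A by (simp add: q_def)
    then have "n \<le> A * n / k" using n k0 A by simp
    then have "k \<le> A" using k0 n0 by (simp add: field_simps)
    then show ?thesis using k A by (simp add: ennreal_leI)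
  qed (use k in simp)
qed

text \<open>Fatou's lemma along a sequence of \<epsilon> tending to 0: the damping factors tend to 1
  for each fixed \<open>t\<close>, and the bound for the damped integrals does not depend on
  \<epsilon>.\<close>

lemma hardy_op_norm_ge_finite_exponent:
  assumes p: "1 \<le> p" "p \<noteq> \<infinity>" and \<alpha>: "\<alpha> > -1" and \<phi>: "\<phi> \<in> borel_measurable (lebesgue_on {0<..})"
    and nn: "\<And>t. t > 0 \<Longrightarrow> \<phi> t \<ge> 0" and bdd: "hausdorff_bounded p \<alpha> \<phi>"
  shows "(\<integral>\<^sup>+t. ennreal (t powr (hardy_exponent p \<alpha> - 1) * \<phi> t) \<partial>lebesgue_on {0<..}) \<le> hardy_op_norm p \<alpha> (hausdorff_op \<phi>)"
proof -
  let ?M = "lebesgue_on {0<..} :: real measure"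
  let ?\<sigma> = "hardy_exponent p \<alpha>"
  have "0 < enn2real p"
    using p enn2real_mono[of 1 p] by (simp add: less_top)
  then have \<sigma>0: "0 < ?\<sigma>" using p \<alpha> by (simp add: hardy_exponent_def)
  \<comment> \<open>Any number in (0, 1/2) could replace 1/3; the minimum with the exponent keeps
    the test functions in the space.\<close>
  define \<epsilon> where "\<epsilon> n = min ?\<sigma> (1 / 3) / real (Suc n)" for n
  have \<epsilon>: "0 < \<epsilon> n" "\<epsilon> n < 1/2" "\<epsilon> n \<le> ?\<sigma>" for n
  proof -
    show "0 < \<epsilon> n" using \<sigma>0 by (simp add: \<epsilon>_def)
    have "\<epsilon> n \<le> min ?\<sigma> (1 / 3) / 1"
      unfolding \<epsilon>_def using \<sigma>0 by (intro divide_left_mono) auto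
    then show "\<epsilon> n < 1/2" "\<epsilon> n \<le> ?\<sigma>" by auto
  qed
  have \<epsilon>lim: "\<epsilon> \<longlonglongrightarrow> 0"
    unfolding \<epsilon>_def by (rule LIMSEQ_Suc[OF lim_const_over_n])
  let ?u = "\<lambda>n t. ennreal (cos (pi * \<epsilon> n) * min t (1 / t) powr \<epsilon> n * (t powr (?\<sigma> - 1) * \<phi> t))"
  have idM: "(\<lambda>t::real. t) \<in> borel_measurable ?M"
    by (rule continuous_imp_measurable_on_sets_lebesgue) auto
  have meas: "?u n \<in> borel_measurable ?M" for n using idM \<phi> by measurable
  have "(\<integral>\<^sup>+t. ennreal (t powr (?\<sigma> - 1) * \<phi> t) \<partial>?M) = (\<integral>\<^sup>+t. liminf (\<lambda>n. ?u n t) \<partial>?M)"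
  proof (intro nn_integral_cong)
    fix t assume "t \<in> space ?M"
    then have t: "0 < t" by simp
    \<comment> \<open>The base must be non-zero for its power to tend to 1, because
      \<open>0 powr 0\<close> is 0.\<close>
    have min0: "min t (1 / t) \<noteq> 0" using t by (simp add: min_def)
    have "(\<lambda>n. cos (pi * \<epsilon> n) * min t (1 / t) powr \<epsilon> n * (t powr (?\<sigma> - 1) * \<phi> t)) \<longlonglongrightarrow>
        cos (pi * 0) * min t (1 / t) powr 0 * (t powr (?\<sigma> - 1) * \<phi> t)"
      using min0 by (intro tendsto_intros \<epsilon>lim) auto
    then have "(\<lambda>n. ?u n t) \<longlonglongrightarrow> ennreal (t powr (?\<sigma> - 1) * \<phi> t)"
      using min0 by (intro tendsto_ennrealI) simp
    then show "ennreal (t powr (?\<sigma> - 1) * \<phi> t) = liminf (\<lambda>n. ?u n t)"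
      by (intro lim_imp_Liminf[symmetric]) auto
  qed
  also have "\<dots> \<le> liminf (\<lambda>n. \<integral>\<^sup>+t. ?u n t \<partial>?M)"
    by (rule nn_integral_liminf[OF meas])
  also have "\<dots> \<le> liminf (\<lambda>n::nat. hardy_op_norm p \<alpha> (hausdorff_op \<phi>))"
    by (intro Liminf_mono always_eventually allI hardy_op_norm_ge_truncated[OF p \<alpha> \<phi> nn bdd \<epsilon>])
  also have "\<dots> = hardy_op_norm p \<alpha> (hausdorff_op \<phi>)" by (simp add: Liminf_const)
  finally show ?thesis .
qed

text \<open>On the constant 1 the operator integrates \<open>\<phi> t / t\<close>, which is the
  integrand for exponent 0. Well-definedness gives integrability, and evaluation at \<i> gives the
  bound.\<close>

lemma hardy_op_norm_ge_infinite_exponent: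
  assumes nn: "\<And>t. t > 0 \<Longrightarrow> \<phi> t \<ge> 0" and bdd: "hausdorff_bounded \<infinity> \<alpha> \<phi>"
  shows "(\<integral>\<^sup>+t. ennreal (t powr (hardy_exponent \<infinity> \<alpha> - 1) * \<phi> t) \<partial>lebesgue_on {0<..}) \<le> hardy_op_norm \<infinity> \<alpha> (hausdorff_op \<phi>)"
proof -
  let ?M = "lebesgue_on {0<..} :: real measure"
  define f where "f = (\<lambda>z::complex. 1 :: complex)"
  have i: "\<i> \<in> upper_half_plane" by (simp add: upper_half_plane_def)
  have norm1: "hardy_norm \<infinity> \<alpha> f \<le> 1" by (simp add: hardy_norm_def f_def SUP_le_iff)
  then have f: "f \<in> hardy_space \<infinity> \<alpha>"
    using order_le_less_trans[OF norm1, of \<infinity>] by (simp add: hardy_space_def f_def)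
  have "integrable ?M (hausdorff_integrand \<phi> f \<i>)"
    using bdd f i by (auto simp: hausdorff_bounded_def hausdorff_defined_def)
  then have int: "integrable ?M (\<lambda>t. of_real (\<phi> t / t) :: complex)"
    by (simp add: hausdorff_integrand_def[abs_def] f_def)
  then have intr: "integrable ?M (\<lambda>t. \<phi> t / t)"
    using integrable_Re[OF int] by (simp only: Re_complex_of_real)
  have "(\<integral>\<^sup>+t. ennreal (t powr (hardy_exponent \<infinity> \<alpha> - 1) * \<phi> t) \<partial>?M) = (\<integral>\<^sup>+t. ennreal (\<phi> t / t) \<partial>?M)"
    by (intro nn_integral_cong) (simp add: hardy_exponent_def powr_minus divide_inverse mult.commute)
  also have "\<dots> = ennreal (LINT t|?M. \<phi> t / t)"
    using intr nn by (intro nn_integral_eq_integral) (auto intro!: AE_I2)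
  also have "\<dots> \<le> ennreal (cmod (hausdorff_op \<phi> f \<i>))"
    unfolding hausdorff_op_def hausdorff_integrand_def f_def mult_1 integral_complex_of_real
    by (intro ennreal_leI) simp
  also have "\<dots> \<le> hardy_norm \<infinity> \<alpha> (hausdorff_op \<phi> f)"
    unfolding hardy_norm_def using i by (auto intro: SUP_upper)
  also have "\<dots> \<le> hardy_op_norm \<infinity> \<alpha> (hausdorff_op \<phi>)"
    unfolding hardy_op_norm_def using f norm1 by (intro SUP_upper) auto
  finally show ?thesis .
qed

text \<open>\<open>b\<close> is any finite bound for the norm: b = 1 yields the operator norm
  estimate, and the norm of \<open>f\<close> itself yields that the image stays in the
  space.\<close>

lemma hausdorff_op_hardy_norm_le:
  assumes p: "1 \<le> p" and \<phi>: "\<phi> \<in> borel_measurable (lebesgue_on {0<..})"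
    and nn: "\<And>t. t > 0 \<Longrightarrow> \<phi> t \<ge> 0"
    and K: "(\<integral>\<^sup>+t. ennreal (t powr (hardy_exponent p \<alpha> - 1) * \<phi> t) \<partial>lebesgue_on {0<..}) = ennreal K" "0 \<le> K"
    and f: "f \<in> hardy_space p \<alpha>" and b: "hardy_norm p \<alpha> f \<le> ennreal b" "0 \<le> b"
  shows "hausdorff_defined \<phi> f \<and> hausdorff_op \<phi> f holomorphic_on upper_half_plane \<and>
    hardy_norm p \<alpha> (hausdorff_op \<phi> f) \<le> ennreal (K * b)"
proof (cases "p = \<infinity>")
  case False
  define q where "q = enn2real p"
  have q: "1 \<le> q" using p False enn2real_mono[of 1 p] by (simp add: q_def less_top)
  have \<sigma>: "hardy_exponent p \<alpha> = (1 + \<alpha>) / q" using False by (simp add: hardy_exponent_def q_def)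
  have fh: "f holomorphic_on upper_half_plane" using f by (simp add: hardy_space_def)
  have I: "line_integral q \<alpha> f y \<le> ennreal (b powr q)" if "0 < y" for y
    using b that hardy_norm_le_iff[OF p False] by (simp add: q_def)
  have fin: "(\<integral>\<^sup>+t. ennreal (t powr ((1 + \<alpha>) / q - 1) * \<phi> t) \<partial>lebesgue_on {0<..}) < \<infinity>"
    using K by (simp add: \<sigma>)
  have def: "hausdorff_defined \<phi> f" "hausdorff_op \<phi> f holomorphic_on upper_half_plane"
    by (rule hausdorff_op_finite_exponent[OF q fh \<phi> _ fin], erule nn, erule I)+
  have "line_integral q \<alpha> (hausdorff_op \<phi> f) y \<le> ennreal ((K * b) powr q)" if "0 < y" for y
    by (rule hausdorff_op_line_integral_bound[OF q fh \<phi> _ K(1)[unfolded \<sigma>] K(2) _ b(2) def(1) that], erule nn, erule I)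
  then show ?thesis
    using def hardy_norm_le_iff[OF p False, of "K * b"] K b by (simp add: q_def)
next
  case True
  have fh: "f holomorphic_on upper_half_plane" using f by (simp add: hardy_space_def)
  have fb: "cmod (f z) \<le> b" if "0 < Im z" for z
  proof -
    have "ennreal (cmod (f z)) \<le> ennreal b"
      using b(1) that unfolding True hardy_norm_def by (simp add: SUP_le_iff upper_half_plane_def)
    then show ?thesis using b by simp
  qed
  have K': "(\<integral>\<^sup>+t. ennreal (t powr (0 - 1) * \<phi> t) \<partial>lebesgue_on {0<..}) = ennreal K"
    using K(1) by (simp add: True hardy_exponent_def)
  have op: "open upper_half_plane" by (simp add: upper_half_plane_def open_halfspace_Im_gt)
  have dom: "\<exists>r>0. \<exists>C. ball z0 r \<subseteq> upper_half_plane \<and>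
      (\<forall>z\<in>ball z0 r. \<forall>t>0. cmod (f (z / of_real t)) \<le> C * t powr 0)" if z0: "z0 \<in> upper_half_plane" for z0
  proof -
    obtain r where "r > 0" "ball z0 r \<subseteq> upper_half_plane" using op z0 open_contains_ball by blast
    then show ?thesis
      by (intro exI[of _ r] conjI exI[of _ b]) (auto simp: upper_half_plane_def subset_iff intro!: fb)
  qed
  have fin: "(\<integral>\<^sup>+t. ennreal (t powr (0 - 1) * \<phi> t) \<partial>lebesgue_on {0<..}) < \<infinity>"
    unfolding K' by simp
  have def: "hausdorff_defined \<phi> f" "hausdorff_op \<phi> f holomorphic_on upper_half_plane"
    by (rule hausdorff_op_holomorphic[OF fh \<phi> _ fin], erule nn, erule dom)+
  have "ennreal (cmod (hausdorff_op \<phi> f z)) \<le> ennreal (K * b)" if z: "z \<in> upper_half_plane" for z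
  proof -
    have "ennreal (cmod (hausdorff_op \<phi> f z)) \<le> (\<integral>\<^sup>+t. ennreal (cmod (hausdorff_integrand \<phi> f z t)) \<partial>lebesgue_on {0<..})"
      unfolding hausdorff_op_def using def(1) z
      by (intro integral_norm_bound_ennreal) (auto simp: hausdorff_defined_def)
    also have "\<dots> \<le> (\<integral>\<^sup>+t. ennreal b * ennreal (t powr (0 - 1) * \<phi> t) \<partial>lebesgue_on {0<..})"
    proof (intro nn_integral_mono)
      fix t :: real assume "t \<in> space (lebesgue_on {0<..})"
      then have t: "0 < t" by simp
      have "cmod (f (z / of_real t)) * (\<phi> t / t) \<le> b * (\<phi> t / t)"
        using z t nn[OF t] by (intro mult_right_mono fb) (auto simp: upper_half_plane_def)
      moreover have "cmod (hausdorff_integrand \<phi> f z t) = cmod (f (z / of_real t)) * (\<phi> t / t)"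
        using t nn[OF t] by (simp add: hausdorff_integrand_def norm_mult norm_divide)
      moreover have "t powr (0 - 1) * \<phi> t = \<phi> t / t"
        using t by (simp add: powr_minus divide_inverse mult.commute)
      ultimately have "cmod (hausdorff_integrand \<phi> f z t) \<le> b * (t powr (0 - 1) * \<phi> t)"
        by (simp only:)
      then show "ennreal (cmod (hausdorff_integrand \<phi> f z t)) \<le> ennreal b * ennreal (t powr (0 - 1) * \<phi> t)"
        using b(2) nn[OF t] by (simp add: ennreal_mult[symmetric] ennreal_leI)
    qed
    also have "\<dots> = ennreal b * ennreal K"
    proof -
      have "(\<lambda>t::real. t) \<in> borel_measurable (lebesgue_on {0<..})"
        by (rule continuous_imp_measurable_on_sets_lebesgue) auto
      then have "(\<lambda>t. ennreal (t powr (0 - 1) * \<phi> t)) \<in> borel_measurable (lebesgue_on {0<..})"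
        using \<phi> by measurable
      then show ?thesis unfolding K'[symmetric] by (rule nn_integral_cmult)
    qed
    also have "\<dots> = ennreal (K * b)" using K b by (simp add: ennreal_mult[symmetric] mult.commute)
    finally show ?thesis .
  qed
  then show ?thesis
    using def by (auto simp: True hardy_norm_def SUP_le_iff)
qed

theorem corollary1p2:
  fixes p :: ennreal and \<alpha> :: real and \<phi> :: "real \<Rightarrow> real"
  assumes "1 \<le> p" and "\<alpha> > -1"
    and "\<phi> \<in> borel_measurable (lebesgue_on {0<..})"
    and "\<And>t. t > 0 \<Longrightarrow> \<phi> t \<ge> 0"
  shows "(hausdorff_bounded p \<alpha> \<phi> \<longleftrightarrow>
      (\<integral>\<^sup>+t. ennreal (t powr (hardy_exponent p \<alpha> - 1) * \<bar>\<phi> t\<bar>) \<partial>lebesgue_on {0<..}) < \<infinity>)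
    \<and> (hausdorff_bounded p \<alpha> \<phi> \<longrightarrow>
      hardy_op_norm p \<alpha> (hausdorff_op \<phi>) =
      (\<integral>\<^sup>+t. ennreal (t powr (hardy_exponent p \<alpha> - 1) * \<phi> t) \<partial>lebesgue_on {0<..}))"
proof -
  let ?K = "\<integral>\<^sup>+t. ennreal (t powr (hardy_exponent p \<alpha> - 1) * \<phi> t) \<partial>lebesgue_on {0<..}"
  let ?N = "hardy_op_norm p \<alpha> (hausdorff_op \<phi>)"
  have abs: "(\<integral>\<^sup>+t. ennreal (t powr (hardy_exponent p \<alpha> - 1) * \<bar>\<phi> t\<bar>) \<partial>lebesgue_on {0<..}) = ?K"
    by (intro nn_integral_cong) (simp add: assms(4))
  have upper: "hausdorff_bounded p \<alpha> \<phi> \<and> ?N \<le> ?K" if fin: "?K < \<infinity>"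
  proof -
    obtain K where K: "?K = ennreal K" "0 \<le> K" using fin by (cases ?K) auto
    have *: "hausdorff_defined \<phi> f \<and> hausdorff_op \<phi> f holomorphic_on upper_half_plane \<and>
        hardy_norm p \<alpha> (hausdorff_op \<phi> f) \<le> ennreal (K * b)"
      if "f \<in> hardy_space p \<alpha>" "hardy_norm p \<alpha> f \<le> ennreal b" "0 \<le> b" for f b
      by (rule hausdorff_op_hardy_norm_le[OF assms(1,3) _ K that]) (rule assms(4))
    have "?N \<le> ennreal K"
      unfolding hardy_op_norm_def by (rule SUP_least) (use *[of _ 1] in auto)
    moreover have "hausdorff_defined \<phi> f \<and> hausdorff_op \<phi> f \<in> hardy_space p \<alpha>" if f: "f \<in> hardy_space p \<alpha>" for f
    proof -
      have "hardy_norm p \<alpha> f < \<infinity>" using f by (simp add: hardy_space_def)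
      then obtain b where "hardy_norm p \<alpha> f = ennreal b" "0 \<le> b" by (cases "hardy_norm p \<alpha> f") auto
      with *[OF f, of b] show ?thesis
        using order_le_less_trans[OF _ ennreal_less_top] by (auto simp: hardy_space_def)
    qed
    ultimately show ?thesis
      using K order_le_less_trans[OF _ ennreal_less_top] by (auto simp: hausdorff_bounded_def)
  qed
  have lower: "?K \<le> ?N" if "hausdorff_bounded p \<alpha> \<phi>"
  proof (cases "p = \<infinity>")
    case True
    show ?thesis
      unfolding True by (rule hardy_op_norm_ge_infinite_exponent) (use assms(4) that True in auto)
  next
    case False
    show ?thesis by (rule hardy_op_norm_ge_finite_exponent[OF assms(1) False assms(2,3) _ that]) (rule assms(4))
  qed
  have "?N < \<infinity>" if "hausdorff_bounded p \<alpha> \<phi>"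
    using that by (simp add: hausdorff_bounded_def)
  \<comment> \<open>The lower bound serves twice: as half of the norm formula, and, since a bounded
    operator has finite norm, as the necessity of the integral condition.\<close>
  then have "hausdorff_bounded p \<alpha> \<phi> \<longleftrightarrow> ?K < \<infinity>"
    using lower upper by (meson order_le_less_trans)
  then show ?thesis
    using lower upper unfolding abs by (meson antisym)
qed

end
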